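(* Let $1\leq p<\infty$, $\alpha>0$, and let $\varphi$ be a nonnegative measurable function on $(0,\infty)$. Then $\mathscr H_\varphi$ is bounded on $\mathcal A^p_\alpha(\mathbb C_+)$ if and only if $\int_0^\infty t^{\frac{1+\alpha}{p}-1}|\varphi(t)|\,dt<\infty$; moreover, in this case, $$\|\mathscr H_\varphi\|_{\mathcal A^p_\alpha(\mathbb C_+)\to\mathcal A^p_\alpha(\mathbb C_+)}=\int_0^\infty t^{\frac{1+\alpha}{p}-1}\varphi(t)\,dt.$$
   Context: $\mathbb C_+=\{x+iy\in\mathbb C: y>0\}$ is the upper half-plane. For a measurable function $\varphi$ on $(0,\infty)$, the Hausdorff operator is defined for suitable holomorphic functions $f$ on $\mathbb C_+$ by $\mathscr H_\varphi f(z)=\int_0^\infty f\left(\frac zt\right)\frac{\varphi(t)}{t}\,dt$, $z\in\mathbb C_+$. For $0<p<\infty$ and $\alpha>0$, the weighted Bergman space $\mathcal A^p_\alpha(\mathbb C_+)$ is the set of all holomorphic functions $f$ on $\mathbb C_+$ with $\|f\|_{\mathcal A^p_\alpha(\mathbb C_+)}:=\left(\int_{\mathbb C_+}|f(x+iy)|^p\,y^{\alpha-1}\,dx\,dy\right)^{1/p}<\infty$. An operator is bounded on a normed space $X$ if it is well-defined on every $f\in X$ (here: the defining integral makes sense as a Lebesgue integral), maps $X$ into $X$, and has finite operator norm $\|\cdot\|_{X\to X}$. *)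

theory Defs
  imports "HOL-Complex_Analysis.Complex_Analysis"
begin

definition upper_half_plane :: "complex set" where
  "upper_half_plane = {z. Im z > 0}"

text \<open>
  Elements of the Bergman space are represented by total functions on \<^typ>\<open>complex\<close>; membership,
  norm and the Hausdorff operator on the upper half-plane depend only on the values there.
  The measure \<^term>\<open>lborel :: complex measure\<close> is the planar Lebesgue measure \<open>dx dy\<close>; a holomorphic
  function is continuous, so integrability just means that the integral of the nonnegative
  integrand is finite.
\<close>

definition bergman_space :: "real \<Rightarrow> real \<Rightarrow> (complex \<Rightarrow> complex) set" where
  "bergman_space p \<alpha> = {f. f holomorphic_on upper_half_plane \<and>
     set_integrable lborel upper_half_plane (\<lambda>z. cmod (f z) powr p * Im z powr (\<alpha> - 1))}"

definition bergman_norm :: "real \<Rightarrow> real \<Rightarrow> (complex \<Rightarrow> complex) \<Rightarrow> real" where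
  "bergman_norm p \<alpha> f =
     (LINT z:upper_half_plane|lborel. cmod (f z) powr p * Im z powr (\<alpha> - 1)) powr (1 / p)"

definition hausdorff_integrand :: "(real \<Rightarrow> real) \<Rightarrow> (complex \<Rightarrow> complex) \<Rightarrow> complex \<Rightarrow> real \<Rightarrow> complex" where
  "hausdorff_integrand \<phi> f z t = f (z / of_real t) * of_real (\<phi> t / t)"

definition hausdorff_op :: "(real \<Rightarrow> real) \<Rightarrow> (complex \<Rightarrow> complex) \<Rightarrow> complex \<Rightarrow> complex" where
  "hausdorff_op \<phi> f z = (LINT t:{0<..}|lebesgue. hausdorff_integrand \<phi> f z t)"

text \<open>The set whose supremum is the operator norm of \<open>T\<close> on the Bergman space.\<close>

definition bergman_op_values ::
    "real \<Rightarrow> real \<Rightarrow> ((complex \<Rightarrow> complex) \<Rightarrow> complex \<Rightarrow> complex) \<Rightarrow> real set" where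
  "bergman_op_values p \<alpha> T =
     {bergman_norm p \<alpha> (T f) | f. f \<in> bergman_space p \<alpha> \<and> bergman_norm p \<alpha> f \<le> 1}"

text \<open>A real supremum, hence meaningful only when \<^const>\<open>bergman_op_values\<close> is bounded above.\<close>

definition bergman_op_norm ::
    "real \<Rightarrow> real \<Rightarrow> ((complex \<Rightarrow> complex) \<Rightarrow> complex \<Rightarrow> complex) \<Rightarrow> real" where
  "bergman_op_norm p \<alpha> T = Sup (bergman_op_values p \<alpha> T)"

text \<open>
  The first conjunct is the well-definedness of the operator: without it, the Bochner integral
  in \<^const>\<open>hausdorff_op\<close> would silently be \<open>0\<close>. The last one says that the operator norm is finite.
\<close>

definition hausdorff_bounded_on_bergman :: "real \<Rightarrow> real \<Rightarrow> (real \<Rightarrow> real) \<Rightarrow> bool" where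
  "hausdorff_bounded_on_bergman p \<alpha> \<phi> \<longleftrightarrow>
     (\<forall>f\<in>bergman_space p \<alpha>. \<forall>z\<in>upper_half_plane.
        set_integrable lebesgue {0<..} (hausdorff_integrand \<phi> f z)) \<and>
     (\<forall>f\<in>bergman_space p \<alpha>. hausdorff_op \<phi> f \<in> bergman_space p \<alpha>) \<and>
     bdd_above (bergman_op_values p \<alpha> (hausdorff_op \<phi>))"

end

theory Submission
  imports Defs
begin

text \<open>
  Put \<open>b = (1 + \<alpha>) / p\<close>. The normalized dilations \<open>f \<mapsto> t powr -b * f (z / t)\<close> are isometries of the
  Bergman space and the Hausdorff operator is their average with weight \<open>k t = t powr (b - 1) * \<phi> t\<close>.
  Hence, by Jensen's inequality and Tonelli's theorem, its norm is at most \<open>\<integral> k\<close> if the latter is finite;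
  convergence of the defining integral and holomorphy follow from the growth estimate
  \<open>f z = O(Im z powr -b)\<close>.

  The test functions are \<open>(1 - \<i> z) powr -(b + e)\<close> with \<open>e \<rightarrow> 0\<close>, whose norms tend to infinity.
  In a narrow sector around the imaginary axis all their dilates have nearly vanishing argument, so that
  there is no cancellation in the Hausdorff operator; this gives \<open>\<integral> k \<le> C\<close> for some constant \<open>C\<close>
  depending on the operator norm, and thus the finiteness of \<open>\<integral> k\<close>. Once \<open>k\<close> is integrable, the sharp lower bound
  holds because the test functions are asymptotically invariant under each normalized dilation,
  relative to their norms, and therefore approximate eigenfunctions with eigenvalue \<open>\<integral> k\<close>.
\<close>

section \<open>Planar Lebesgue measure and the area mean value inequality\<close>

text \<open>The exponent \<open>b\<close> is critical: (1 - i z) powr -b just misses the space,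
  through a logarithmic divergence at infinity. Hence the mass of \<open>test_fun (b + e)\<close> is
  at least c / e, while its part in any bounded region stays bounded. Only the behaviour at infinity
  matters, and there (1 - i z) / (t - i z) tends to 1. The obstacle is that comparing
  \<open>T f\<close> with \<open>K\<close> times \<open>f\<close> presupposes a finite
  \<open>K\<close>. The finiteness argument therefore works with the kernel truncated to {1 / R..R},
  where crude constants suffice as long as they do not depend on R. Estimates are made for the p-th
  power of the norm as an extended nonnegative integral, so Tonelli applies before finiteness is
  known. Sharp constants survive because Jensen's inequality is used with the exact mass of the
  kernel, and the triangle inequality in the form of a weighted split whose main coefficient tends
  to 1.\<close>

lemma lborel_complex_eq:
  "(lborel :: complex measure) = distr (lborel \<Otimes>\<^sub>M lborel) borel (\<lambda>(x, y). Complex x y)"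
proof (rule lborel_eqI)
  fix l u :: complex
  assume le: "\<And>b. b \<in> Basis \<Longrightarrow> l \<bullet> b \<le> u \<bullet> b"
  have meas: "(\<lambda>(x, y). Complex x y) \<in> borel_measurable (lborel \<Otimes>\<^sub>M lborel)"
    unfolding Complex_eq by measurable
  have "(\<lambda>(x, y). Complex x y) -` box l u \<inter> space (lborel \<Otimes>\<^sub>M lborel)
      = {Re l<..<Re u} \<times> {Im l<..<Im u}"
    by (auto simp: box_def Basis_complex_def space_pair_measure)
  moreover have "Re l \<le> Re u" "Im l \<le> Im u"
    using le[of 1] le[of \<i>] by (auto simp: Basis_complex_def)
  ultimately show "emeasure (distr (lborel \<Otimes>\<^sub>M lborel) borel (\<lambda>(x, y). Complex x y)) (box l u)
      = ennreal (\<Prod>b\<in>Basis. (u - l) \<bullet> b)"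
    using meas by (simp add: emeasure_distr lborel.emeasure_pair_measure_Times Basis_complex_def
        ennreal_mult)
qed simp

lemma borel_measurable_Complex [measurable (raw)]:
  assumes "f \<in> borel_measurable M" "g \<in> borel_measurable M"
  shows "(\<lambda>x. Complex (f x) (g x)) \<in> borel_measurable M"
  unfolding Complex_eq using assms by measurable

lemma nn_integral_lborel_complex:
  assumes [measurable]: "g \<in> borel_measurable borel"
  shows "(\<integral>\<^sup>+z. g z \<partial>lborel) = (\<integral>\<^sup>+x. \<integral>\<^sup>+y. g (Complex x y) \<partial>lborel \<partial>lborel)"
    and "(\<integral>\<^sup>+z. g z \<partial>lborel) = (\<integral>\<^sup>+y. \<integral>\<^sup>+x. g (Complex x y) \<partial>lborel \<partial>lborel)"
proof -
  have "(\<integral>\<^sup>+z. g z \<partial>lborel) = (\<integral>\<^sup>+q. g (Complex (fst q) (snd q)) \<partial>(lborel \<Otimes>\<^sub>M lborel))"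
    by (subst lborel_complex_eq, subst nn_integral_distr) (auto simp: case_prod_unfold)
  then show 1: "(\<integral>\<^sup>+z. g z \<partial>lborel) = (\<integral>\<^sup>+x. \<integral>\<^sup>+y. g (Complex x y) \<partial>lborel \<partial>lborel)"
    by (subst (asm) lborel.nn_integral_fst[symmetric]) auto
  show "(\<integral>\<^sup>+z. g z \<partial>lborel) = (\<integral>\<^sup>+y. \<integral>\<^sup>+x. g (Complex x y) \<partial>lborel \<partial>lborel)"
    unfolding 1 by (rule lborel_pair.Fubini') simp
qed

text \<open>For \<open>cos \<theta> \<noteq> 0\<close> a rotation is a composition of an affine substitution in \<open>x\<close> and one in \<open>y\<close>.\<close>

lemma nn_integral_lborel_rotate:
  fixes \<theta> :: real
  assumes [measurable]: "g \<in> borel_measurable borel" and c: "cos \<theta> \<noteq> 0"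
  shows "(\<integral>\<^sup>+z. g (cis \<theta> * z) \<partial>lborel) = (\<integral>\<^sup>+z. g z \<partial>lborel)"
proof -
  define c s where "c = cos \<theta>" and "s = sin \<theta>"
  have c0: "c \<noteq> 0" and cs: "c * c + s * s = 1"
    using c by (auto simp: c_def s_def cos_squared_eq simp flip: power2_eq_square)
  \<comment> \<open>The new variable is the first coordinate of the rotated point. The factor |c|
    produced here cancels against the one in \<open>outer\<close>.\<close>
  have inner: "ennreal \<bar>c\<bar> * (\<integral>\<^sup>+x. g (cis \<theta> * Complex x y) \<partial>lborel)
      = (\<integral>\<^sup>+x. g (Complex x (x * s / c + y / c)) \<partial>lborel)" for y
  proof -
    have "(c * x - y * s) * s / c + y / c = x * s + y * c" for x
    proof -
      have "y * (c * c + s * s) = y" using cs by simp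
      then show ?thesis using c0 by (simp add: field_simps)
    qed
    then have "cis \<theta> * Complex x y = Complex (- (y * s) + c * x) ((- (y * s) + c * x) * s / c + y / c)"
      for x by (simp add: complex_eq_iff c_def s_def algebra_simps)
    then show ?thesis
      by (subst (2) nn_integral_real_affine[OF _ c0, of _ "- (y * s)"]) auto
  qed
  have outer: "(\<integral>\<^sup>+y. g (Complex x (x * s / c + y / c)) \<partial>lborel) = ennreal \<bar>c\<bar> * (\<integral>\<^sup>+y. g (Complex x y) \<partial>lborel)" for x
  proof -
    have "(\<integral>\<^sup>+y. g (Complex x y) \<partial>lborel)
        = ennreal \<bar>1 / c\<bar> * (\<integral>\<^sup>+y. g (Complex x (x * s / c + 1 / c * y)) \<partial>lborel)"
      using c0 by (intro nn_integral_real_affine) auto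
    moreover have "ennreal \<bar>c\<bar> * ennreal \<bar>1 / c\<bar> = 1"
      using c0 by (simp flip: ennreal_mult)
    ultimately show ?thesis by (simp add: mult.assoc[symmetric])
  qed
  have "ennreal \<bar>c\<bar> * (\<integral>\<^sup>+z. g (cis \<theta> * z) \<partial>lborel)
      = (\<integral>\<^sup>+y. ennreal \<bar>c\<bar> * (\<integral>\<^sup>+x. g (cis \<theta> * Complex x y) \<partial>lborel) \<partial>lborel)"
    by (subst nn_integral_lborel_complex(2)) (auto simp: nn_integral_cmult)
  also have "\<dots> = (\<integral>\<^sup>+x. \<integral>\<^sup>+y. g (Complex x (x * s / c + y / c)) \<partial>lborel \<partial>lborel)"
    unfolding inner by (rule lborel_pair.Fubini'[symmetric]) simp
  also have "\<dots> = ennreal \<bar>c\<bar> * (\<integral>\<^sup>+z. g z \<partial>lborel)"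
    unfolding outer by (subst nn_integral_lborel_complex(1)) (auto simp: nn_integral_cmult)
  finally show ?thesis
    using c0 by (simp add: ennreal_mult_cancel_left)
qed

lemma nn_integral_lborel_dilate:
  fixes t :: real and g :: "complex \<Rightarrow> ennreal"
  assumes [measurable]: "g \<in> borel_measurable borel" and t: "t > 0"
  shows "(\<integral>\<^sup>+z. g (z / of_real t) \<partial>lborel) = ennreal (t\<^sup>2) * (\<integral>\<^sup>+z. g z \<partial>lborel)"
proof -
  have "(\<integral>\<^sup>+z. g (z / of_real t) \<partial>lborel) = ennreal (t\<^sup>2) * (\<integral>\<^sup>+z. g ((t *\<^sub>R z) / of_real t) \<partial>lborel)"
    using t by (subst lborel_affine[of t 0])
      (auto simp: nn_integral_density nn_integral_distr nn_integral_cmult ennreal_power)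
  then show ?thesis
    using t by (simp add: scaleR_conv_of_real)
qed

text \<open>Cauchy's formula at the centre of a circle. The circle is parametrised by rotating one
  of its points, so that integrating over w leads to rotation invariance of the area measure instead
  of polar coordinates.\<close>

lemma norm_le_circle_average:
  assumes f: "f holomorphic_on cball z r" and w: "norm w \<le> r"
  shows "ennreal (cmod (f z)) \<le> (\<integral>\<^sup>+t\<in>{0..1}. ennreal (cmod (f (z + cis (2 * pi * t) * w))) \<partial>lborel)"
proof -
  \<comment> \<open>Rescaling by w moves the circle to the unit circle and includes the degenerate
    case w = 0.\<close>
  define g where "g v = f (z + v * w)" for v
  have sub: "z + v * w \<in> cball z r" if "norm v \<le> 1" for v
  proof -
    have "norm v * norm w \<le> 1 * r" using that w by (intro mult_mono) auto
    then show ?thesis by (simp add: dist_norm norm_mult)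
  qed
  have "(\<lambda>v. f (z + v * w)) holomorphic_on cball 0 1"
    by (intro holomorphic_on_compose_gen[OF _ f, unfolded o_def] holomorphic_intros)
      (use sub in auto)
  then have g: "g holomorphic_on cball 0 1" unfolding g_def .
  have "((\<lambda>u. g u / (u - 0)) has_contour_integral (2 * of_real pi * \<i> * g 0)) (circlepath 0 1)"
    by (rule Cauchy_integral_circlepath_simple[OF g]) simp
  then have "((\<lambda>t. g (circlepath 0 1 t) / (circlepath 0 1 t - 0) * vector_derivative (circlepath 0 1) (at t))
      has_integral (2 * of_real pi * \<i> * g 0)) {0..1}"
    by (simp only: has_contour_integral)
  moreover have "g (circlepath 0 1 t) / (circlepath 0 1 t - 0) * vector_derivative (circlepath 0 1) (at t)
      = g (cis (2 * pi * t)) * (2 * pi * \<i>)" for t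
    by (simp only: vector_derivative_circlepath) (simp add: circlepath cis_conv_exp mult_ac)
  ultimately have J: "((\<lambda>t. g (cis (2 * pi * t)) * (2 * pi * \<i>)) has_integral (g 0 * (2 * pi * \<i>))) {0..1}"
    by (simp add: mult_ac)
  have K: "complex_of_real (2 * pi) * \<i> \<noteq> 0" by simp
  have I: "((\<lambda>t. g (cis (2 * pi * t))) has_integral g 0) {0..1}"
    using has_integral_mult_left[OF J, of "inverse (2 * pi * \<i>)"]
    by (simp only: mult.assoc[of _ "complex_of_real (2 * pi) * \<i>"] right_inverse[OF K] mult_1_right)
  have "continuous_on {0..1} (\<lambda>t. g (cis (2 * pi * t)))"
    by (rule continuous_on_compose2[OF holomorphic_on_imp_continuous_on[OF g]])
      (auto intro!: continuous_intros simp: cis_conv_exp)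
  then have S: "set_integrable lborel {0..1} (\<lambda>t. g (cis (2 * pi * t)))"
    by (rule borel_integrable_atLeastAtMost')
  have "g 0 = (LINT t:{0..1}|lborel. g (cis (2 * pi * t)))"
    using set_borel_integral_eq_integral(2)[OF S] I by (simp add: integral_unique)
  then have "ennreal (cmod (g 0)) \<le> (\<integral>\<^sup>+t. norm (indicator {0..1} t *\<^sub>R g (cis (2 * pi * t))) \<partial>lborel)"
    using integral_norm_bound_ennreal[OF S[unfolded set_integrable_def]]
    by (simp add: set_lebesgue_integral_def)
  also have "\<dots> = (\<integral>\<^sup>+t\<in>{0..1}. ennreal (cmod (g (cis (2 * pi * t)))) \<partial>lborel)"
    by (intro nn_integral_cong) (auto simp: indicator_def)
  finally show ?thesis by (simp add: g_def)
qed

text \<open>The rotation lemma excludes the angles with vanishing cosine; these are countably many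
  and hence negligible in the average over the circle.\<close>

lemma AE_cos_ne_0: "AE t in lborel. cos (2 * pi * t) \<noteq> (0::real)"
proof -
  have "{t. cos (2 * pi * t) = 0} \<subseteq> (\<lambda>i. of_int i / 4) ` (UNIV :: int set)"
  proof
    fix t assume "t \<in> {t. cos (2 * pi * t) = 0}"
    then obtain i where "odd i" "2 * pi * t = of_int i * (pi / 2)"
      by (auto simp: cos_zero_iff_int)
    then have "pi * (4 * t) = pi * of_int i" by (simp add: field_simps)
    then have "t = of_int i / 4" by simp
    then show "t \<in> (\<lambda>i. of_int i / 4) ` (UNIV :: int set)" by blast
  qed
  then have "countable {t. cos (2 * pi * t) = (0::real)}"
    by (rule countable_subset) auto
  then show ?thesis
    by (intro AE_I'[OF countable_imp_null_set_lborel]) auto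
qed

text \<open>Integrate the circle inequality over w in the disc and exchange the integrals: for
  almost every t the inner integral is the same disc integral, by rotation invariance.\<close>

lemma area_mean_value:
  fixes f :: "complex \<Rightarrow> complex"
  assumes f: "f holomorphic_on cball z r" and r: "r > 0"
  shows "ennreal (pi * r\<^sup>2) * ennreal (cmod (f z)) \<le> (\<integral>\<^sup>+w\<in>ball z r. ennreal (cmod (f w)) \<partial>lborel)"
proof -
  define F where "F w = ennreal (indicator (ball 0 r) w * cmod (f (z + w)))" for w :: complex
  have "continuous_on (ball 0 r) (\<lambda>w. cmod (f (z + w)))"
    by (intro continuous_on_norm continuous_on_compose2[OF holomorphic_on_imp_continuous_on[OF f]]
        continuous_intros) (auto simp: dist_norm)
  then have [measurable]: "F \<in> borel_measurable borel"
    unfolding F_def using borel_measurable_continuous_on_indicator[of "ball 0 r" "\<lambda>w. cmod (f (z + w))"]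
    by auto
  have "emeasure lborel (ball (0::complex) r) = ennreal (pi * r\<^sup>2)"
    using r by (simp add: emeasure_ball unit_ball_vol_2)
  then have "ennreal (pi * r\<^sup>2) * ennreal (cmod (f z))
      = (\<integral>\<^sup>+w. ennreal (cmod (f z)) * indicator (ball (0::complex) r) w \<partial>lborel)"
    by (subst nn_integral_cmult_indicator) (auto simp: mult.commute)
  also have "\<dots> \<le> (\<integral>\<^sup>+w. (\<integral>\<^sup>+t\<in>{0..1}. F (cis (2 * pi * t) * w) \<partial>lborel) \<partial>lborel)"
  proof (intro nn_integral_mono)
    fix w
    show "ennreal (cmod (f z)) * indicator (ball 0 r) w
        \<le> (\<integral>\<^sup>+t\<in>{0..1}. F (cis (2 * pi * t) * w) \<partial>lborel)"
    proof (cases "w \<in> ball 0 r")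
      case True
      then have "ennreal (cmod (f z)) \<le> (\<integral>\<^sup>+t\<in>{0..1}. ennreal (cmod (f (z + cis (2 * pi * t) * w))) \<partial>lborel)"
        by (intro norm_le_circle_average[OF f]) auto
      also have "\<dots> = (\<integral>\<^sup>+t\<in>{0..1}. F (cis (2 * pi * t) * w) \<partial>lborel)"
        using True by (intro nn_integral_cong) (auto simp: F_def norm_mult indicator_def)
      finally show ?thesis using True by simp
    qed simp
  qed
  also have "\<dots> = (\<integral>\<^sup>+t\<in>{0..1}. (\<integral>\<^sup>+w. F (cis (2 * pi * t) * w) \<partial>lborel) \<partial>lborel)"
  proof -
    have [measurable]: "cis \<in> borel_measurable borel"
      by (intro borel_measurable_continuous_onI) (simp add: cis_conv_exp continuous_intros)
    show ?thesis
      by (subst lborel_pair.Fubini') (auto simp: nn_integral_multc)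
  qed
  also have "\<dots> = (\<integral>\<^sup>+t\<in>{0..1}. (\<integral>\<^sup>+w. F w \<partial>lborel) \<partial>(lborel :: real measure))"
    using AE_cos_ne_0 by (intro nn_integral_cong_AE) (auto elim!: eventually_mono simp: nn_integral_lborel_rotate)
  also have "\<dots> = (\<integral>\<^sup>+w. F w \<partial>lborel)"
    by (subst nn_integral_cmult_indicator) auto
  also have "\<dots> = (\<integral>\<^sup>+w. F (- z + w) \<partial>lborel)"
    by (subst lborel_distr_plus[of "- z", symmetric], subst nn_integral_distr) auto
  also have "\<dots> = (\<integral>\<^sup>+w\<in>ball z r. ennreal (cmod (f w)) \<partial>lborel)"
    by (intro nn_integral_cong) (auto simp: F_def indicator_def dist_norm norm_minus_commute)
  finally show ?thesis .
qed

section \<open>Convexity inequalities for powers\<close>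

lemma powr_above_tangent:
  fixes p c x :: real
  assumes "1 \<le> p" "0 < c" "0 \<le> x"
  shows "c powr p + p * c powr (p - 1) * (x - c) \<le> x powr p"
\<comment> \<open>The tangent inequality comes from convexity on the open half-line; at the endpoint
  it reduces to (1 - p) * c powr p being nonpositive.\<close>
proof (cases "x = 0")
  case True
  have "c powr p = c powr (p - 1) * c"
    using assms powr_mult_base[of c "p - 1"] by (simp add: mult.commute)
  then have "c powr p + p * c powr (p - 1) * (0 - c) = (1 - p) * (c powr (p - 1) * c)"
    by (simp add: algebra_simps)
  also have "\<dots> \<le> 0"
    using assms by (intro mult_nonpos_nonneg) auto
  finally show ?thesis using True assms by simp
next
  case False
  have "x powr p - c powr p \<ge> (p * c powr (p - 1)) * (x - c)"
    using assms False
    by (intro convex_on_imp_above_tangent[where A = "{0<..}"] powr_convex)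
      (auto intro!: derivative_eq_intros simp: interior_open)
  then show ?thesis by simp
qed

text \<open>Jensen's inequality for the convex combination a + b = (1 - l) * (a / (1 - l)) + l * (b
  / l), obtained by adding the tangent inequalities at c = a + b, whose linear terms cancel.\<close>

lemma powr_add_le_split:
  fixes p a b l :: real
  assumes p: "1 \<le> p" and ab: "0 \<le> a" "0 \<le> b" and l: "0 < l" "l < 1"
  shows "(a + b) powr p \<le> (1 - l) powr (1 - p) * a powr p + l powr (1 - p) * b powr p"
proof (cases "a + b = 0")
  case True
  then show ?thesis using p by simp
next
  case False
  define c where "c = a + b"
  have c: "0 < c" using False ab by (simp add: c_def)
  have scale: "q * (u / q) powr p = q powr (1 - p) * u powr p" if "0 < q" "0 \<le> u" for q u
    using that by (simp add: powr_divide powr_diff)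
  have "c powr p = (1 - l) * (c powr p + p * c powr (p - 1) * (a / (1 - l) - c))
      + l * (c powr p + p * c powr (p - 1) * (b / l - c))"
  proof -
    have "(1 - l) * (a / (1 - l) - c) + l * (b / l - c) = 0"
      using l by (simp add: c_def field_simps)
    moreover have "(1 - l) * (C + q * A) + l * (C + q * B) = C + q * ((1 - l) * A + l * B)" for C q A B
      by (simp add: algebra_simps)
    ultimately show ?thesis by simp
  qed
  also have "\<dots> \<le> (1 - l) * (a / (1 - l)) powr p + l * (b / l) powr p"
    using l ab c p by (intro add_mono mult_left_mono powr_above_tangent) auto
  also have "\<dots> = (1 - l) powr (1 - p) * a powr p + l powr (1 - p) * b powr p"
    using l ab by (simp add: scale)
  finally show ?thesis by (simp add: c_def)
qed

text \<open>Jensen's inequality for the measure with density k. Its total mass K is not normalized,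
  which accounts for the factor K powr (p - 1).\<close>

lemma powr_integral_le_weighted:
  fixes g k :: "'a \<Rightarrow> real"
  assumes p: "1 \<le> p" and [measurable]: "g \<in> borel_measurable M" and g: "\<And>t. 0 \<le> g t"
    and k: "\<And>t. 0 \<le> k t" and ik: "integrable M k" and igk: "integrable M (\<lambda>t. g t * k t)"
  shows "ennreal ((\<integral>t. g t * k t \<partial>M) powr p)
    \<le> ennreal ((\<integral>t. k t \<partial>M) powr (p - 1)) * (\<integral>\<^sup>+t. ennreal (g t powr p * k t) \<partial>M)"
proof -
  define K J where "K = (\<integral>t. k t \<partial>M)" and "J = (\<integral>t. g t * k t \<partial>M)"
  have [measurable]: "k \<in> borel_measurable M" using ik by auto
  have K0: "0 \<le> K" and J0: "0 \<le> J"
    unfolding K_def J_def using g k by (auto intro!: integral_nonneg_AE)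
  show ?thesis
  \<comment> \<open>The tangent point will be the weighted mean J / K, so K and J must be positive
    and the right-hand side finite. If K = 0, then k vanishes almost everywhere and J = 0
    too.\<close>
  proof (cases "K = 0 \<or> J = 0 \<or> \<not> integrable M (\<lambda>t. g t powr p * k t)")
    case True
    then consider "J = 0" | "K = 0" | "0 < K" "\<not> integrable M (\<lambda>t. g t powr p * k t)"
      using K0 by fastforce
    then show ?thesis
    proof cases
      case 1 then show ?thesis using p by (simp flip: J_def)
    next
      case 2
      then have "AE t in M. k t = 0"
        unfolding K_def using integral_nonneg_eq_0_iff_AE[OF ik] k by auto
      then have "J = 0" unfolding J_def
        by (intro integral_eq_zero_AE) (auto elim: eventually_mono)
      then show ?thesis using p by (simp flip: J_def)
    next
      case 3
      then have "(\<integral>\<^sup>+t. ennreal (g t powr p * k t) \<partial>M) = \<infinity>"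
        using k by (subst (asm) integrable_iff_bounded) (auto simp: not_less top_unique)
      then show ?thesis using 3 by (simp flip: K_def add: ennreal_mult_top)
    qed
  next
    case False
    define c where "c = J / K"
    have c: "0 < c" and K: "0 < K" using False K0 J0 by (auto simp: c_def)
    have ip: "integrable M (\<lambda>t. g t powr p * k t)" using False by simp
    \<comment> \<open>The linear term integrates to a multiple of J - c * K = 0.\<close>
    have "c powr p * K = (\<integral>t. c powr p * k t + p * c powr (p - 1) * (g t * k t - c * k t) \<partial>M)"
      using ik igk K by (simp add: K_def[symmetric] J_def[symmetric] c_def)
    also have "\<dots> \<le> (\<integral>t. g t powr p * k t \<partial>M)"
    proof (intro integral_mono ip)
      fix t
      have "(c powr p + p * c powr (p - 1) * (g t - c)) * k t \<le> g t powr p * k t"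
        using p c g k by (intro mult_right_mono powr_above_tangent) auto
      then show "c powr p * k t + p * c powr (p - 1) * (g t * k t - c * k t) \<le> g t powr p * k t"
        by (simp add: algebra_simps)
    qed (use ik igk in auto)
    finally have "K powr (p - 1) * (c powr p * K) \<le> K powr (p - 1) * (\<integral>t. g t powr p * k t \<partial>M)"
      by (intro mult_left_mono) auto
    moreover have "K powr (p - 1) * (c powr p * K) = J powr p"
      using K J0 by (simp add: c_def powr_divide powr_diff)
    ultimately have "ennreal (J powr p) \<le> ennreal (K powr (p - 1) * (\<integral>t. g t powr p * k t \<partial>M))"
      by (intro ennreal_leI) simp
    also have "\<dots> = ennreal (K powr (p - 1)) * (\<integral>\<^sup>+t. ennreal (g t powr p * k t) \<partial>M)"
      using ip g k by (subst nn_integral_eq_integral) (auto simp: ennreal_mult intro!: integral_nonneg_AE)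
    finally show ?thesis by (simp add: J_def K_def)
  qed
qed

section \<open>Holomorphy of integrals depending on a parameter\<close>

lemma holomorphic_on_lebesgue_integral:
  fixes F :: "complex \<Rightarrow> 'a \<Rightarrow> complex"
  assumes S: "open S" and hol: "\<And>t. t \<in> space M \<Longrightarrow> (\<lambda>z. F z t) holomorphic_on S"
    and meas: "\<And>z. z \<in> S \<Longrightarrow> F z \<in> borel_measurable M"
    and bound: "\<And>z0. z0 \<in> S \<Longrightarrow> \<exists>r>0. \<exists>h. cball z0 r \<subseteq> S \<and> integrable M h \<and>
       (\<forall>z\<in>cball z0 r. \<forall>t\<in>space M. cmod (F z t) \<le> h t)"
  shows "(\<lambda>z. \<integral>t. F z t \<partial>M) holomorphic_on S"
proof -
  have "(\<lambda>z. \<integral>t. F z t \<partial>M) field_differentiable at z0" if z0: "z0 \<in> S" for z0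
  proof -
    obtain r h where r: "r > 0" "cball z0 r \<subseteq> S" and h: "integrable M h"
      and Fh: "\<And>z t. z \<in> cball z0 r \<Longrightarrow> t \<in> space M \<Longrightarrow> cmod (F z t) \<le> h t"
      using bound[OF z0] by blast
    \<comment> \<open>Half the radius, so that the disc of radius r / 2 about each point of B stays
      where h is a majorant.\<close>
    define B where "B = ball z0 (r / 2)"
    define D where "D t = deriv (\<lambda>z. F z t) z0" for t
    have BS: "B \<subseteq> S" and Bop: "open B" and z0B: "z0 \<in> B"
      using r by (auto simp: B_def subset_eq)
    have int: "integrable M (F z)" if "z \<in> B" for z
      using meas[of z] BS that r
      by (intro Bochner_Integration.integrable_bound[OF h])
        (auto intro!: AE_I2 order_trans[OF Fh] simp: B_def)
    have der: "((\<lambda>z. F z t) has_field_derivative D t) (at z0)" if "t \<in> space M" for t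
      unfolding D_def using holomorphic_derivI[OF hol[OF that] S z0] .
    \<comment> \<open>Cauchy's inequality on radius r / 2 bounds the derivative on B, hence the
      difference quotients; this is the majorant for dominated convergence.\<close>
    have quot: "cmod ((F w t - F z0 t) / (w - z0)) \<le> 2 / r * h t"
      if w: "w \<in> B" "w \<noteq> z0" and t: "t \<in> space M" for w t
    proof -
      have "cmod (F w t - F z0 t) \<le> (2 / r * h t) * cmod (w - z0)"
      proof (rule field_differentiable_bound[of B _ "deriv (\<lambda>z. F z t)"])
        fix z assume z: "z \<in> B"
        show "((\<lambda>z. F z t) has_field_derivative deriv (\<lambda>z. F z t) z) (at z within B)"
          using holomorphic_derivI[OF hol[OF t] S] BS z by (meson has_field_derivative_at_within subsetD)
        have sub: "cball z (r / 2) \<subseteq> cball z0 r"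
        proof
          fix v assume "v \<in> cball z (r / 2)"
          then show "v \<in> cball z0 r"
            using z dist_triangle[of z0 v z] by (simp add: B_def)
        qed
        have hz: "(\<lambda>z. F z t) holomorphic_on cball z (r / 2)"
          using hol[OF t] sub r by (meson holomorphic_on_subset order_trans)
        have "cmod ((deriv ^^ 1) (\<lambda>z. F z t) z) \<le> fact 1 * h t / (r / 2) ^ 1"
          using r sub t
          by (intro Cauchy_inequality holomorphic_on_subset[OF hz] holomorphic_on_imp_continuous_on[OF hz] Fh)
            (auto simp: dist_norm)
        then show "cmod (deriv (\<lambda>z. F z t) z) \<le> 2 / r * h t" by (simp add: mult.commute)
      qed (use w z0B in \<open>auto simp: B_def\<close>)
      then show ?thesis using w by (simp add: norm_divide divide_le_eq)
    qed
    have "((\<lambda>w. ((\<integral>t. F w t \<partial>M) - (\<integral>t. F z0 t \<partial>M)) / (w - z0)) \<longlongrightarrow> (\<integral>t. D t \<partial>M)) (at z0 within B)"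
      unfolding tendsto_at_iff_sequentially
    proof (intro allI impI)
      fix X assume XB: "\<forall>i. X i \<in> B - {z0}" and X: "X \<longlonglongrightarrow> z0"
      have lim: "(\<lambda>i. (F (X i) t - F z0 t) / (X i - z0)) \<longlonglongrightarrow> D t" if t: "t \<in> space M" for t
      proof -
        have "((\<lambda>w. (F w t - F z0 t) / (w - z0)) \<longlongrightarrow> D t) (at z0 within B)"
          using der[OF t] by (simp only: has_field_derivative_iff at_within_open[OF z0B Bop])
        then have "((\<lambda>w. (F w t - F z0 t) / (w - z0)) \<circ> X) \<longlonglongrightarrow> D t"
          using XB X unfolding tendsto_at_iff_sequentially by blast
        then show ?thesis by (simp only: comp_def)
      qed
      have mq: "(\<lambda>t. (F (X i) t - F z0 t) / (X i - z0)) \<in> borel_measurable M" for i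
      proof -
        have [measurable]: "F (X i) \<in> borel_measurable M" "F z0 \<in> borel_measurable M"
          using meas BS XB z0 by auto
        show ?thesis by measurable
      qed
      \<comment> \<open>Measurability of the derivative in t is inherited from the quotients of
        which it is the pointwise limit.\<close>
      have "D \<in> borel_measurable M"
        by (rule borel_measurable_LIMSEQ_metric[OF mq lim])
      then have "(\<lambda>i. \<integral>t. (F (X i) t - F z0 t) / (X i - z0) \<partial>M) \<longlonglongrightarrow> (\<integral>t. D t \<partial>M)"
        using XB by (intro integral_dominated_convergence[where w = "\<lambda>t. 2 / r * h t"] mq AE_I2 lim quot)
          (use h in auto)
      moreover have "(\<integral>t. (F (X i) t - F z0 t) / (X i - z0) \<partial>M)
          = ((\<integral>t. F (X i) t \<partial>M) - (\<integral>t. F z0 t \<partial>M)) / (X i - z0)" for i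
        by (subst Bochner_Integration.integral_diff[symmetric])
          (use int XB z0B in \<open>auto intro!: integral_divide_zero\<close>)
      ultimately show "((\<lambda>w. ((\<integral>t. F w t \<partial>M) - (\<integral>t. F z0 t \<partial>M)) / (w - z0)) \<circ> X) \<longlonglongrightarrow> (\<integral>t. D t \<partial>M)"
        by (simp only: comp_def)
    qed
    then have "((\<lambda>z. \<integral>t. F z t \<partial>M) has_field_derivative (\<integral>t. D t \<partial>M)) (at z0)"
      by (simp only: has_field_derivative_iff at_within_open[OF z0B Bop])
    then show ?thesis by (auto simp: field_differentiable_def)
  qed
  then show ?thesis
    using S by (simp add: holomorphic_on_open field_differentiable_def)
qed

section \<open>Weighted Bergman spaces\<close>

text \<open>The p-th power of the norm, with value \<infinity> instead of the default 0 of a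
  divergent Bochner integral, so that finiteness can be read off from bounds.\<close>

definition bergman_mass :: "real \<Rightarrow> real \<Rightarrow> (complex \<Rightarrow> complex) \<Rightarrow> ennreal" where
  "bergman_mass p \<alpha> f =
     (\<integral>\<^sup>+z\<in>upper_half_plane. ennreal (cmod (f z) powr p * Im z powr (\<alpha> - 1)) \<partial>lborel)"

lemma open_upper_half_plane: "open upper_half_plane"
  unfolding upper_half_plane_def by (rule open_halfspace_Im_gt)

lemma upper_half_plane_measurable [measurable]: "upper_half_plane \<in> sets borel"
  using open_upper_half_plane by simp

lemma of_real_divide_mem_upper_half_plane:
  "z \<in> upper_half_plane \<Longrightarrow> z / of_real t \<in> upper_half_plane \<longleftrightarrow> 0 < t"
  by (auto simp: upper_half_plane_def zero_less_divide_iff)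

text \<open>Total functions have arbitrary values off the half-plane, so measurability is available
  only after this cutoff.\<close>

lemma restrict_upper_half_plane_measurable:
  fixes f :: "complex \<Rightarrow> complex"
  assumes "continuous_on upper_half_plane f"
  shows "(\<lambda>z. indicator upper_half_plane z *\<^sub>R f z) \<in> borel_measurable borel"
  using assms by (intro borel_measurable_continuous_on_indicator) auto

lemma bergman_density_measurable:
  assumes f: "continuous_on upper_half_plane f"
  shows "(\<lambda>z. ennreal (cmod (f z) powr p * Im z powr (\<alpha> - 1)) * indicator upper_half_plane z)
    \<in> borel_measurable borel"
proof -
  note [measurable] = restrict_upper_half_plane_measurable[OF f]
  have "(\<lambda>z. ennreal (cmod (indicator upper_half_plane z *\<^sub>R f z) powr p * Im z powr (\<alpha> - 1))
      * indicator upper_half_plane z) \<in> borel_measurable borel"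
    by measurable
  then show ?thesis
    by (rule measurable_cong[THEN iffD1, rotated]) (auto simp: indicator_def)
qed

lemma set_density_measurable:
  assumes f: "continuous_on upper_half_plane f"
  shows "(\<lambda>z. indicator upper_half_plane z *\<^sub>R (cmod (f z) powr p * Im z powr (\<alpha> - 1)))
    \<in> borel_measurable lborel"
proof -
  have "(\<lambda>z. enn2real (ennreal (cmod (f z) powr p * Im z powr (\<alpha> - 1)) * indicator upper_half_plane z))
      \<in> borel_measurable lborel"
    using bergman_density_measurable[OF f] by simp
  then show ?thesis
    by (rule measurable_cong[THEN iffD1, rotated]) (auto simp: indicator_def)
qed

lemma bergman_mass_eq:
  "bergman_mass p \<alpha> f =
    (\<integral>\<^sup>+z. ennreal (indicator upper_half_plane z *\<^sub>R (cmod (f z) powr p * Im z powr (\<alpha> - 1))) \<partial>lborel)"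
  unfolding bergman_mass_def by (intro nn_integral_cong) (auto simp: indicator_def)

lemma bergman_space_iff:
  "f \<in> bergman_space p \<alpha> \<longleftrightarrow> f holomorphic_on upper_half_plane \<and> bergman_mass p \<alpha> f < \<infinity>"
proof -
  have "set_integrable lborel upper_half_plane (\<lambda>z. cmod (f z) powr p * Im z powr (\<alpha> - 1))
      \<longleftrightarrow> bergman_mass p \<alpha> f < \<infinity>" if "f holomorphic_on upper_half_plane"
    using set_density_measurable[OF holomorphic_on_imp_continuous_on[OF that], of p \<alpha>]
    unfolding set_integrable_def integrable_iff_bounded bergman_mass_eq
    by (simp cong: nn_integral_cong)
  then show ?thesis by (auto simp: bergman_space_def)
qed

lemma bergman_norm_eq:
  assumes "f \<in> bergman_space p \<alpha>"
  shows "bergman_norm p \<alpha> f = enn2real (bergman_mass p \<alpha> f) powr (1 / p)"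
proof -
  have "continuous_on upper_half_plane f"
    using assms holomorphic_on_imp_continuous_on by (auto simp: bergman_space_def)
  then show ?thesis
    unfolding bergman_norm_def set_lebesgue_integral_def bergman_mass_eq
    by (subst integral_eq_nn_integral[OF set_density_measurable]) auto
qed

lemma ennreal_bergman_norm_powr:
  assumes "f \<in> bergman_space p \<alpha>" "p \<noteq> 0"
  shows "ennreal (bergman_norm p \<alpha> f powr p) = bergman_mass p \<alpha> f"
  using assms by (auto simp: bergman_norm_eq powr_powr bergman_space_iff less_top)

lemma bergman_mass_cmult:
  assumes "continuous_on upper_half_plane f"
  shows "bergman_mass p \<alpha> (\<lambda>z. c * f z) = ennreal (cmod c powr p) * bergman_mass p \<alpha> f"
proof -
  have "bergman_mass p \<alpha> (\<lambda>z. c * f z)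
      = (\<integral>\<^sup>+z. ennreal (cmod c powr p) *
          (ennreal (cmod (f z) powr p * Im z powr (\<alpha> - 1)) * indicator upper_half_plane z) \<partial>lborel)"
    unfolding bergman_mass_def
    by (intro nn_integral_cong) (auto simp: indicator_def norm_mult powr_mult mult.assoc simp flip: ennreal_mult)
  then show ?thesis
    using bergman_density_measurable[OF assms] by (simp add: nn_integral_cmult bergman_mass_def)
qed

text \<open>The area contributes t squared and the weight t powr (\<alpha> - 1). Taking p-th roots
  gives the normalizing exponent (1 + \<alpha>) / p of the dilations.\<close>

lemma bergman_mass_dilate:
  assumes f: "continuous_on upper_half_plane f" and t: "0 < t"
  shows "bergman_mass p \<alpha> (\<lambda>z. f (z / of_real t)) = ennreal (t powr (1 + \<alpha>)) * bergman_mass p \<alpha> f"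
proof -
  define G where "G = (\<lambda>z. ennreal (cmod (f z) powr p * Im z powr (\<alpha> - 1)) * indicator upper_half_plane z)"
  have [measurable]: "G \<in> borel_measurable borel"
    unfolding G_def by (rule bergman_density_measurable[OF f])
  have *: "ennreal (cmod (f (z / of_real t)) powr p * Im z powr (\<alpha> - 1)) * indicator upper_half_plane z
      = ennreal (t powr (\<alpha> - 1)) * G (z / of_real t)" for z
    using t by (auto simp: G_def indicator_def upper_half_plane_def powr_divide zero_less_divide_iff
        simp flip: ennreal_mult)
  have "bergman_mass p \<alpha> (\<lambda>z. f (z / of_real t)) = (\<integral>\<^sup>+z. ennreal (t powr (\<alpha> - 1)) * G (z / of_real t) \<partial>lborel)"
    unfolding bergman_mass_def * ..
  also have "\<dots> = ennreal (t powr (\<alpha> - 1)) * (ennreal (t\<^sup>2) * (\<integral>\<^sup>+z. G z \<partial>lborel))"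
    using t by (simp add: nn_integral_cmult nn_integral_lborel_dilate)
  also have "\<dots> = ennreal (t powr (\<alpha> - 1) * t powr 2) * (\<integral>\<^sup>+z. G z \<partial>lborel)"
    using t by (simp add: mult.assoc ennreal_mult)
  also have "t powr (\<alpha> - 1) * t powr 2 = t powr (1 + \<alpha>)"
    by (simp flip: powr_add)
  finally show ?thesis by (simp add: bergman_mass_def G_def)
qed

text \<open>The mean value over the disc of radius \<open>Im z / 2\<close>, on which \<open>Im\<close> is comparable to \<open>Im z\<close>;
  Hoelder's inequality is replaced by \<open>a \<le> 1 + a powr p\<close>.\<close>

lemma bergman_pointwise_bound:
  assumes p: "1 \<le> p" and f: "f \<in> bergman_space p \<alpha>"
  obtains C where "0 \<le> C" "\<And>z. z \<in> upper_half_plane \<Longrightarrow> cmod (f z) \<le> C * Im z powr (- ((1 + \<alpha>) / p))"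
proof -
  define m where "m = enn2real (bergman_mass p \<alpha> f)"
  have m: "bergman_mass p \<alpha> f = ennreal m" "0 \<le> m"
    using f by (auto simp: m_def bergman_space_iff less_top)
  \<comment> \<open>Bounds the ratio of the weights at z and at a point of the disc, whose height
    lies between y / 2 and 3 / 2 * y; the absolute value serves both signs of \<alpha> - 1.\<close>
  define D where "D = (2::real) powr \<bar>\<alpha> - 1\<bar>"
  define C where "C = 1 + 4 * D * m / pi"
  have hol: "f holomorphic_on upper_half_plane" using f by (simp add: bergman_space_iff)
  have "cmod (f z) \<le> C * Im z powr (- ((1 + \<alpha>) / p))" if z: "z \<in> upper_half_plane" for z
  proof -
    define y where "y = Im z"
    have y: "0 < y" using z by (simp add: y_def upper_half_plane_def)
    have near: "y / 2 \<le> Im w \<and> Im w \<le> 3 / 2 * y" if "w \<in> cball z (y / 2)" for w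
    proof -
      have "\<bar>Im (z - w)\<bar> \<le> y / 2"
        using that abs_Im_le_cmod[of "z - w"] by (simp add: dist_norm)
      then have "\<bar>y - Im w\<bar> \<le> y / 2" by (simp add: y_def)
      then show ?thesis by linarith
    qed
    have sub: "cball z (y / 2) \<subseteq> upper_half_plane"
      using near y by (force simp: upper_half_plane_def)
    have subb: "ball z (y / 2) \<subseteq> upper_half_plane"
      using ball_subset_cball sub by (rule order_trans)
    have bp: "y powr ((1 + \<alpha>) / p) * cmod (f w)
        \<le> 1 + y\<^sup>2 * D * (cmod (f w) powr p * Im w powr (\<alpha> - 1))" if w: "w \<in> ball z (y / 2)" for w
    proof -
      have v: "0 < Im w" "y / 2 \<le> Im w" "Im w \<le> 3 / 2 * y"
        using near[of w] w y by auto
      have "y powr (\<alpha> - 1) / Im w powr (\<alpha> - 1) \<le> D"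
      proof (cases "\<alpha> \<ge> 1")
        case True
        have "(y / Im w) powr (\<alpha> - 1) \<le> 2 powr (\<alpha> - 1)"
          using True v y by (intro powr_mono2) (auto simp: field_simps)
        then show ?thesis using True v y by (simp add: D_def powr_divide)
      next
        case False
        have "(Im w / y) powr (1 - \<alpha>) \<le> 2 powr (1 - \<alpha>)"
          using False v y by (intro powr_mono2) (auto simp: field_simps)
        moreover have "(Im w / y) powr (1 - \<alpha>) = y powr (\<alpha> - 1) / Im w powr (\<alpha> - 1)"
          using v y by (simp add: powr_divide powr_diff)
        ultimately show ?thesis using False by (simp add: D_def)
      qed
      then have yD: "y powr (\<alpha> - 1) \<le> D * Im w powr (\<alpha> - 1)"
        using v by (simp add: field_simps)
      \<comment> \<open>Scaling by y powr ((1 + \<alpha>) / p) before applying a <= 1 + a powr p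
        makes both sides of the mean value estimate proportional to y ^ 2.\<close>
      define a where "a = y powr ((1 + \<alpha>) / p) * cmod (f w)"
      have a: "0 \<le> a" by (simp add: a_def)
      have "a \<le> 1 + a powr p"
      proof (cases "a \<le> 1")
        case False
        then have "a powr 1 \<le> a powr p" using p by (intro powr_mono) auto
        then show ?thesis using False by simp
      qed (simp add: add_increasing2)
      also have "a powr p = y powr (1 + \<alpha>) * cmod (f w) powr p"
        using p by (simp add: a_def powr_mult powr_powr)
      also have "y powr (1 + \<alpha>) = y\<^sup>2 * y powr (\<alpha> - 1)"
        using y by (simp flip: powr_add powr_numeral)
      also have "\<dots> * cmod (f w) powr p \<le> y\<^sup>2 * (D * Im w powr (\<alpha> - 1)) * cmod (f w) powr p"
        using yD by (intro mult_right_mono mult_left_mono) auto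
      finally show ?thesis by (simp add: a_def mult_ac)
    qed
    have [measurable]: "ball z (y / 2) \<in> sets borel" by simp
    have em: "emeasure lborel (ball z (y / 2)) = ennreal (pi * (y / 2)\<^sup>2)"
      using y by (simp add: emeasure_ball unit_ball_vol_2)
    note [measurable] = bergman_density_measurable[OF holomorphic_on_imp_continuous_on[OF hol], of p \<alpha>]
    have mc: "(\<lambda>w. ennreal (cmod (f w)) * indicator (ball z (y / 2)) w) \<in> borel_measurable borel"
    proof -
      note [measurable] = restrict_upper_half_plane_measurable[OF holomorphic_on_imp_continuous_on[OF hol]]
      have "(\<lambda>w. ennreal (cmod (indicator upper_half_plane w *\<^sub>R f w)) * indicator (ball z (y / 2)) w)
          \<in> borel_measurable borel"
        by measurable
      then show ?thesis
        by (rule measurable_cong[THEN iffD1, rotated]) (use subb in \<open>auto simp: indicator_def simp del: mem_ball\<close>)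
    qed
    have "ennreal (y powr ((1 + \<alpha>) / p)) * (ennreal (pi * (y / 2)\<^sup>2) * ennreal (cmod (f z)))
        \<le> ennreal (y powr ((1 + \<alpha>) / p)) * (\<integral>\<^sup>+w\<in>ball z (y / 2). ennreal (cmod (f w)) \<partial>lborel)"
      using y sub by (intro mult_left_mono area_mean_value holomorphic_on_subset[OF hol]) auto
    also have "\<dots> = (\<integral>\<^sup>+w. ennreal (y powr ((1 + \<alpha>) / p))
        * (ennreal (cmod (f w)) * indicator (ball z (y / 2)) w) \<partial>lborel)"
      using mc by (intro nn_integral_cmult[symmetric]) simp
    also have "\<dots> \<le> (\<integral>\<^sup>+w. indicator (ball z (y / 2)) w + ennreal (y\<^sup>2 * D) *
        (ennreal (cmod (f w) powr p * Im w powr (\<alpha> - 1)) * indicator upper_half_plane w) \<partial>lborel)"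
    proof (intro nn_integral_mono)
      fix w
      have "ennreal (y powr ((1 + \<alpha>) / p)) * ennreal (cmod (f w))
          \<le> 1 + ennreal (y\<^sup>2 * D) * ennreal (cmod (f w) powr p * Im w powr (\<alpha> - 1))"
        if "w \<in> ball z (y / 2)"
      proof -
        have "0 \<le> D" by (simp add: D_def)
        then show ?thesis
          using ennreal_leI[OF bp[OF that]]
          by (simp add: ennreal_mult ennreal_plus flip: ennreal_1)
      qed
      moreover have "w \<in> upper_half_plane" if "w \<in> ball z (y / 2)"
        using that subb by blast
      ultimately show "ennreal (y powr ((1 + \<alpha>) / p)) * (ennreal (cmod (f w)) * indicator (ball z (y / 2)) w)
        \<le> indicator (ball z (y / 2)) w + ennreal (y\<^sup>2 * D) *
        (ennreal (cmod (f w) powr p * Im w powr (\<alpha> - 1)) * indicator upper_half_plane w)"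
        by (cases "w \<in> ball z (y / 2)") (auto simp: indicator_def)
    qed
    also have "\<dots> = ennreal (pi * (y / 2)\<^sup>2) + ennreal (y\<^sup>2 * D) * bergman_mass p \<alpha> f"
      by (subst nn_integral_add) (auto simp: nn_integral_cmult em bergman_mass_def)
    also have "\<dots> = ennreal (pi * (y / 2)\<^sup>2 + y\<^sup>2 * D * m)"
      using m y by (simp add: D_def ennreal_mult)
    also have "ennreal (y powr ((1 + \<alpha>) / p)) * (ennreal (pi * (y / 2)\<^sup>2) * ennreal (cmod (f z)))
        = ennreal (y powr ((1 + \<alpha>) / p) * (pi * (y / 2)\<^sup>2 * cmod (f z)))"
      by (simp add: ennreal_mult)
    finally have "y powr ((1 + \<alpha>) / p) * (pi * (y / 2)\<^sup>2 * cmod (f z)) \<le> pi * (y / 2)\<^sup>2 + y\<^sup>2 * D * m"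
      using m by (subst (asm) ennreal_le_iff) (auto simp: D_def)
    moreover have "(pi * (y / 2)\<^sup>2) * C = pi * (y / 2)\<^sup>2 + y\<^sup>2 * D * m"
      by (simp add: C_def field_simps power2_eq_square)
    ultimately have "(pi * (y / 2)\<^sup>2) * (y powr ((1 + \<alpha>) / p) * cmod (f z)) \<le> (pi * (y / 2)\<^sup>2) * C"
      by (simp add: mult_ac)
    then have "y powr ((1 + \<alpha>) / p) * cmod (f z) \<le> C"
      using y by (subst (asm) mult_le_cancel_left_pos) auto
    then show ?thesis
      using y by (simp add: y_def powr_minus field_simps)
  qed
  moreover have "0 \<le> C" using m by (simp add: C_def D_def)
  ultimately show ?thesis using that by blast
qed

section \<open>The Hausdorff operator of an integrable kernel\<close>

text \<open>Jensen's inequality in t for each z, then Tonelli. The family \<open>G\<close> is kept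
  general because it is applied both to the dilates of f, for the upper bound, and to their
  differences from f, for the lower bound.\<close>

lemma bergman_mass_integral_le:
  fixes G :: "complex \<Rightarrow> real \<Rightarrow> complex" and k :: "real \<Rightarrow> real"
  assumes p: "1 \<le> p" and k: "\<And>t. 0 \<le> k t" and ik: "integrable lborel k"
    and G: "(\<lambda>(z, t). indicator upper_half_plane z *\<^sub>R G z t) \<in> borel_measurable (borel \<Otimes>\<^sub>M borel)"
    and iG: "\<And>z. z \<in> upper_half_plane \<Longrightarrow> integrable lborel (\<lambda>t. G z t * of_real (k t))"
  shows "bergman_mass p \<alpha> (\<lambda>z. \<integral>t. G z t * of_real (k t) \<partial>lborel)
    \<le> ennreal ((\<integral>t. k t \<partial>lborel) powr (p - 1)) * (\<integral>\<^sup>+t. ennreal (k t) * bergman_mass p \<alpha> (\<lambda>z. G z t) \<partial>lborel)"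
proof -
  define K where "K = (\<integral>t. k t \<partial>lborel)"
  define G' where "G' z t = indicator upper_half_plane z *\<^sub>R G z t" for z t
  have [measurable]: "(\<lambda>(z, t). G' z t) \<in> borel_measurable (borel \<Otimes>\<^sub>M borel)"
    using G by (simp add: G'_def)
  have [measurable]: "k \<in> borel_measurable borel" using ik by auto
  define P where "P z t = ennreal (cmod (G' z t) powr p * Im z powr (\<alpha> - 1)) * indicator upper_half_plane z" for z t
  have Pm [measurable]: "(\<lambda>(z, t). P z t) \<in> borel_measurable (borel \<Otimes>\<^sub>M borel)"
    unfolding P_def by measurable
  have P: "bergman_mass p \<alpha> (\<lambda>z. G z t) = (\<integral>\<^sup>+z. P z t \<partial>lborel)" for t
    unfolding bergman_mass_def P_def G'_def by (intro nn_integral_cong) (auto simp: indicator_def)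
  have "bergman_mass p \<alpha> (\<lambda>z. \<integral>t. G z t * of_real (k t) \<partial>lborel)
      \<le> (\<integral>\<^sup>+z. ennreal (K powr (p - 1)) * (\<integral>\<^sup>+t. ennreal (k t) * P z t \<partial>lborel) \<partial>lborel)"
    unfolding bergman_mass_def
  proof (intro nn_integral_mono)
    fix z
    show "ennreal (cmod (\<integral>t. G z t * of_real (k t) \<partial>lborel) powr p * Im z powr (\<alpha> - 1)) * indicator upper_half_plane z
      \<le> ennreal (K powr (p - 1)) * (\<integral>\<^sup>+t. ennreal (k t) * P z t \<partial>lborel)"
    proof (cases "z \<in> upper_half_plane")
      case True
      have GG: "G z = G' z" using True by (simp add: G'_def fun_eq_iff)
      have Gz [measurable]: "G z \<in> borel_measurable borel"
        unfolding GG by measurable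
      have "cmod (\<integral>t. G z t * of_real (k t) \<partial>lborel) \<le> (\<integral>t. cmod (G z t) * k t \<partial>lborel)"
        using integral_norm_bound[of lborel "\<lambda>t. G z t * of_real (k t)"] k by (simp add: norm_mult)
      then have "ennreal (cmod (\<integral>t. G z t * of_real (k t) \<partial>lborel) powr p)
          \<le> ennreal ((\<integral>t. cmod (G z t) * k t \<partial>lborel) powr p)"
        using p by (intro ennreal_leI powr_mono2) auto
      also have "\<dots> \<le> ennreal (K powr (p - 1)) * (\<integral>\<^sup>+t. ennreal (cmod (G z t) powr p * k t) \<partial>lborel)"
        unfolding K_def
        using integrable_norm[OF iG[OF True]] k
        by (intro powr_integral_le_weighted p ik) (auto simp: norm_mult)
      finally have "ennreal (cmod (\<integral>t. G z t * of_real (k t) \<partial>lborel) powr p) * ennreal (Im z powr (\<alpha> - 1))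
          \<le> ennreal (K powr (p - 1)) * (\<integral>\<^sup>+t. ennreal (cmod (G z t) powr p * k t) \<partial>lborel) * ennreal (Im z powr (\<alpha> - 1))"
        by (rule mult_right_mono) simp
      also have "\<dots> = ennreal (K powr (p - 1)) * (\<integral>\<^sup>+t. ennreal (cmod (G z t) powr p * k t) * ennreal (Im z powr (\<alpha> - 1)) \<partial>lborel)"
        by (subst nn_integral_multc) (auto simp: mult.assoc)
      also have "(\<integral>\<^sup>+t. ennreal (cmod (G z t) powr p * k t) * ennreal (Im z powr (\<alpha> - 1)) \<partial>lborel)
          = (\<integral>\<^sup>+t. ennreal (k t) * P z t \<partial>lborel)"
        using True k by (intro nn_integral_cong) (auto simp: P_def G'_def mult_ac simp flip: ennreal_mult)
      finally show ?thesis using True by (simp add: ennreal_mult)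
    qed simp
  qed
  also have "\<dots> = ennreal (K powr (p - 1)) * (\<integral>\<^sup>+z. \<integral>\<^sup>+t. ennreal (k t) * P z t \<partial>lborel \<partial>lborel)"
    by (intro nn_integral_cmult) measurable
  also have "(\<integral>\<^sup>+z. \<integral>\<^sup>+t. ennreal (k t) * P z t \<partial>lborel \<partial>lborel)
      = (\<integral>\<^sup>+t. \<integral>\<^sup>+z. ennreal (k t) * P z t \<partial>lborel \<partial>lborel)"
    by (rule lborel_pair.Fubini'[symmetric]) measurable
  also have "\<dots> = (\<integral>\<^sup>+t. ennreal (k t) * (\<integral>\<^sup>+z. P z t \<partial>lborel) \<partial>lborel)"
    by (intro nn_integral_cong nn_integral_cmult) measurable
  finally show ?thesis by (simp add: P K_def)
qed

text \<open>Here \<open>\<psi>\<close> stands for a Borel modification of the given kernel, extended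
  by 0, so that integrals over the positive half-line become \<open>lborel\<close> integrals over
  all reals.\<close>

locale hausdorff_kernel =
  fixes p \<alpha> :: real and \<psi> :: "real \<Rightarrow> real"
  assumes p: "1 \<le> p" and \<alpha>: "0 < \<alpha>"
    and \<psi>_measurable [measurable]: "\<psi> \<in> borel_measurable borel"
    and \<psi>_nonneg: "\<And>t. 0 \<le> \<psi> t"
    and \<psi>_zero: "\<And>t. t \<le> 0 \<Longrightarrow> \<psi> t = 0"
begin

definition b :: real where "b = (1 + \<alpha>) / p"

definition T :: "(complex \<Rightarrow> complex) \<Rightarrow> complex \<Rightarrow> complex" where
  "T f z = (\<integral>t. hausdorff_integrand \<psi> f z t \<partial>lborel)"

definition k :: "real \<Rightarrow> real" where "k t = t powr (b - 1) * \<psi> t"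

definition K :: real where "K = (\<integral>t. k t \<partial>lborel)"

definition dil :: "(complex \<Rightarrow> complex) \<Rightarrow> complex \<Rightarrow> real \<Rightarrow> complex" where
  "dil f z t = of_real (t powr - b) * f (z / of_real t)"

lemma b_pos: "0 < b" using p \<alpha> by (simp add: b_def)

lemma bp: "b * p = 1 + \<alpha>" using p by (simp add: b_def)

lemma k_measurable [measurable]: "k \<in> borel_measurable borel"
  unfolding k_def by measurable

lemma k_nonneg: "0 \<le> k t" by (simp add: k_def \<psi>_nonneg)

lemma k_zero: "t \<le> 0 \<Longrightarrow> k t = 0" by (simp add: k_def \<psi>_zero)

lemma K_nonneg: "0 \<le> K" unfolding K_def by (intro integral_nonneg_AE) (simp add: k_nonneg)

lemma hausdorff_integrand_eq: "hausdorff_integrand \<psi> f z t = dil f z t * of_real (k t)"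
proof (cases "0 < t")
  case True
  then have "t powr - b * k t = \<psi> t / t"
    by (simp add: k_def powr_diff powr_minus field_simps)
  then show ?thesis by (simp add: hausdorff_integrand_def dil_def mult_ac flip: of_real_mult)
qed (simp add: hausdorff_integrand_def k_zero \<psi>_zero)

lemma T_eq: "T f z = (\<integral>t. dil f z t * of_real (k t) \<partial>lborel)"
  by (simp add: T_def hausdorff_integrand_eq)

lemma T_cmult: "T (\<lambda>z. c * f z) z = c * T f z"
proof -
  have "T (\<lambda>z. c * f z) z = (\<integral>t. c * (dil f z t * of_real (k t)) \<partial>lborel)"
    by (simp add: T_eq dil_def mult_ac)
  then show ?thesis by (simp add: T_eq)
qed

text \<open>Both cutoffs matter: for t <= 0 the point z / t leaves the half-plane, where f may be
  arbitrary.\<close>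

lemma dil_measurable:
  assumes "continuous_on upper_half_plane f"
  shows "(\<lambda>(z, t). indicator upper_half_plane z *\<^sub>R (indicator {0<..} t *\<^sub>R dil f z t))
    \<in> borel_measurable (borel \<Otimes>\<^sub>M borel)"
proof -
  define F where "F z = indicator upper_half_plane z *\<^sub>R f z" for z
  have [measurable]: "F \<in> borel_measurable borel"
    unfolding F_def by (rule restrict_upper_half_plane_measurable[OF assms])
  have "(\<lambda>(z, t). indicator upper_half_plane z *\<^sub>R (indicator {0<..} t *\<^sub>R (of_real (t powr - b) * F (z / of_real t))))
      \<in> borel_measurable (borel \<Otimes>\<^sub>M borel)"
    by measurable
  then show ?thesis
    by (rule measurable_cong[THEN iffD1, rotated])
      (auto simp: F_def dil_def indicator_def of_real_divide_mem_upper_half_plane)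
qed

lemma integrand_measurable:
  assumes f: "continuous_on upper_half_plane f" and z: "z \<in> upper_half_plane"
  shows "hausdorff_integrand \<psi> f z \<in> borel_measurable borel"
proof -
  note [measurable] = dil_measurable[OF f]
  have "(\<lambda>t. (\<lambda>(z, t). indicator upper_half_plane z *\<^sub>R (indicator {0<..} t *\<^sub>R dil f z t)) (z, t) * of_real (k t))
      \<in> borel_measurable borel"
    by measurable
  then show ?thesis
    by (rule measurable_cong[THEN iffD1, rotated])
      (use z in \<open>auto simp: hausdorff_integrand_eq indicator_def k_zero\<close>)
qed

lemma bergman_mass_dil:
  assumes f: "continuous_on upper_half_plane f" and t: "0 < t"
  shows "bergman_mass p \<alpha> (\<lambda>z. dil f z t) = bergman_mass p \<alpha> f"
proof -
  have "continuous_on upper_half_plane (\<lambda>z. f (z / of_real t))"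
    by (intro continuous_on_compose2[OF f] continuous_intros)
      (use t of_real_divide_mem_upper_half_plane in auto)
  then have "bergman_mass p \<alpha> (\<lambda>z. dil f z t)
      = ennreal ((t powr - b) powr p * t powr (1 + \<alpha>)) * bergman_mass p \<alpha> f"
    unfolding dil_def using t
    by (simp add: bergman_mass_cmult bergman_mass_dilate[OF f] ennreal_mult mult.assoc)
  also have "(t powr - b) powr p * t powr (1 + \<alpha>) = 1"
    using t by (simp add: powr_powr bp flip: powr_add)
  finally show ?thesis by simp
qed

text \<open>The growth bound at z / t gains a factor t powr b, which turns
  \<open>\<psi> t / t\<close> into \<open>k t\<close>. The resulting majorant is integrable with
  \<open>k\<close> and locally uniform in z.\<close>

lemma integrand_bound:
  assumes C: "\<And>z. z \<in> upper_half_plane \<Longrightarrow> cmod (f z) \<le> C * Im z powr (- b)"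
    and z: "z \<in> upper_half_plane"
  shows "cmod (hausdorff_integrand \<psi> f z t) \<le> C * Im z powr (- b) * k t"
proof (cases "0 < t")
  case True
  have "cmod (f (z / of_real t)) \<le> C * (Im z / t) powr (- b)"
    using C[of "z / of_real t"] True z by (simp add: of_real_divide_mem_upper_half_plane)
  also have "(Im z / t) powr (- b) = Im z powr - b * t powr b"
    using True z by (simp add: powr_divide upper_half_plane_def powr_minus field_simps)
  finally have "cmod (f (z / of_real t)) * (\<psi> t / t) \<le> C * (Im z powr - b * t powr b) * (\<psi> t / t)"
    using True \<psi>_nonneg by (intro mult_right_mono) auto
  also have "\<dots> = C * Im z powr - b * (t powr b * (\<psi> t / t))" by simp
  also have "t powr b * (\<psi> t / t) = k t"
    using True by (simp add: k_def powr_diff)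
  finally show ?thesis
    using True \<psi>_nonneg by (simp add: hausdorff_integrand_def norm_mult norm_divide)
qed (simp add: hausdorff_integrand_def k_zero \<psi>_zero)

context
  assumes ik: "integrable lborel k"
begin

lemma integrand_integrable:
  assumes f: "f \<in> bergman_space p \<alpha>" and z: "z \<in> upper_half_plane"
  shows "integrable lborel (hausdorff_integrand \<psi> f z)"
proof -
  obtain C where C: "\<And>z. z \<in> upper_half_plane \<Longrightarrow> cmod (f z) \<le> C * Im z powr (- b)"
    using bergman_pointwise_bound[OF p f] unfolding b_def by blast
  have "integrable lborel (\<lambda>t. C * Im z powr (- b) * k t)" using ik by simp
  then show ?thesis
  proof (rule Bochner_Integration.integrable_bound)
    show "hausdorff_integrand \<psi> f z \<in> borel_measurable lborel"
      using integrand_measurable[OF _ z] f holomorphic_on_imp_continuous_on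
      by (simp add: bergman_space_iff)
    show "AE t in lborel. cmod (hausdorff_integrand \<psi> f z t) \<le> norm (C * Im z powr (- b) * k t)"
      using integrand_bound[OF C z] by (auto intro!: AE_I2 order_trans[OF integrand_bound[OF C z]])
  qed
qed

lemma T_holomorphic:
  assumes f: "f \<in> bergman_space p \<alpha>"
  shows "T f holomorphic_on upper_half_plane"
proof -
  obtain C where C0: "0 \<le> C" and C: "\<And>z. z \<in> upper_half_plane \<Longrightarrow> cmod (f z) \<le> C * Im z powr (- b)"
    using bergman_pointwise_bound[OF p f] unfolding b_def by blast
  have hol: "f holomorphic_on upper_half_plane" using f by (simp add: bergman_space_iff)
  have "(\<lambda>z. \<integral>t. hausdorff_integrand \<psi> f z t \<partial>lborel) holomorphic_on upper_half_plane"
  proof (rule holomorphic_on_lebesgue_integral)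
    show "(\<lambda>z. hausdorff_integrand \<psi> f z t) holomorphic_on upper_half_plane" for t
    proof (cases "0 < t")
      case True
      then have "(\<lambda>z. f (z / of_real t)) holomorphic_on upper_half_plane"
        by (intro holomorphic_on_compose_gen[OF _ hol, unfolded o_def] holomorphic_intros)
          (auto simp: of_real_divide_mem_upper_half_plane)
      then show ?thesis unfolding hausdorff_integrand_def by (intro holomorphic_intros)
    qed (simp add: hausdorff_integrand_def \<psi>_zero)
    show "hausdorff_integrand \<psi> f z \<in> borel_measurable lborel" if "z \<in> upper_half_plane" for z
      using integrand_measurable[OF holomorphic_on_imp_continuous_on[OF hol] that] by simp
    fix z0 assume z0: "z0 \<in> upper_half_plane"
    define r where "r = Im z0 / 2"
    have r: "0 < r" using z0 by (simp add: r_def upper_half_plane_def)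
    have Im: "r \<le> Im z" if "z \<in> cball z0 r" for z
    proof -
      have "\<bar>Im (z0 - z)\<bar> \<le> r"
        using that abs_Im_le_cmod[of "z0 - z"] by (simp add: dist_norm)
      then have "\<bar>2 * r - Im z\<bar> \<le> r" by (simp add: r_def)
      then show ?thesis by linarith
    qed
    have sub: "cball z0 r \<subseteq> upper_half_plane"
      using Im r by (force simp: upper_half_plane_def)
    have "cmod (hausdorff_integrand \<psi> f z t) \<le> C * r powr (- b) * k t" if z: "z \<in> cball z0 r" for z t
    proof -
      have "cmod (hausdorff_integrand \<psi> f z t) \<le> C * Im z powr (- b) * k t"
        using z sub by (intro integrand_bound C) auto
      also have "\<dots> \<le> C * r powr (- b) * k t"
        using Im[OF z] r b_pos by (intro mult_right_mono mult_left_mono powr_mono2' C0 k_nonneg) auto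
      finally show ?thesis .
    qed
    moreover have "integrable lborel (\<lambda>t. C * r powr (- b) * k t)" using ik by simp
    ultimately show "\<exists>r>0. \<exists>h. cball z0 r \<subseteq> upper_half_plane \<and> integrable lborel h \<and>
       (\<forall>z\<in>cball z0 r. \<forall>t\<in>space lborel. cmod (hausdorff_integrand \<psi> f z t) \<le> h t)"
      using r sub by blast
  qed (rule open_upper_half_plane)
  then show ?thesis by (simp add: T_def[abs_def])
qed

text \<open>All dilates have the mass of f. Jensen's inequality contributes K powr (p - 1) and the
  integral of \<open>k\<close> the remaining factor K.\<close>

lemma bergman_mass_T_le:
  assumes f: "f \<in> bergman_space p \<alpha>"
  shows "bergman_mass p \<alpha> (T f) \<le> ennreal (K powr p) * bergman_mass p \<alpha> f"
proof -
  have cf: "continuous_on upper_half_plane f"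
    using f holomorphic_on_imp_continuous_on by (auto simp: bergman_space_iff)
  define G where "G z t = indicator {0<..} t *\<^sub>R dil f z t" for z t
  have Gk: "G z t * of_real (k t) = hausdorff_integrand \<psi> f z t" for z t
    by (simp add: G_def hausdorff_integrand_eq indicator_def k_zero)
  have "bergman_mass p \<alpha> (\<lambda>z. \<integral>t. G z t * of_real (k t) \<partial>lborel)
    \<le> ennreal ((\<integral>t. k t \<partial>lborel) powr (p - 1)) * (\<integral>\<^sup>+t. ennreal (k t) * bergman_mass p \<alpha> (\<lambda>z. G z t) \<partial>lborel)"
    using dil_measurable[OF cf] integrand_integrable[OF f]
    by (intro bergman_mass_integral_le p k_nonneg ik) (auto simp: Gk, simp add: G_def)
  also have "(\<integral>\<^sup>+t. ennreal (k t) * bergman_mass p \<alpha> (\<lambda>z. G z t) \<partial>lborel)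
      = (\<integral>\<^sup>+t. ennreal (k t) * bergman_mass p \<alpha> f \<partial>lborel)"
  proof (intro nn_integral_cong)
    fix t
    show "ennreal (k t) * bergman_mass p \<alpha> (\<lambda>z. G z t) = ennreal (k t) * bergman_mass p \<alpha> f"
      using bergman_mass_dil[OF cf, of t] by (cases "0 < t") (auto simp: G_def k_zero)
  qed
  also have "\<dots> = ennreal K * bergman_mass p \<alpha> f"
    using ik by (subst nn_integral_multc) (auto simp: nn_integral_eq_integral k_nonneg K_def)
  finally have "bergman_mass p \<alpha> (T f) \<le> ennreal (K powr (p - 1) * K) * bergman_mass p \<alpha> f"
    by (simp add: Gk T_def[abs_def] K_def[symmetric] ennreal_mult K_nonneg mult.assoc)
  also have "K powr (p - 1) * K = K powr p"
    using K_nonneg powr_mult_base[of K "p - 1"] by (cases "K = 0") (auto simp: mult.commute)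
  finally show ?thesis .
qed

lemma T_bergman_space:
  assumes f: "f \<in> bergman_space p \<alpha>"
  shows "T f \<in> bergman_space p \<alpha>"
proof -
  have "bergman_mass p \<alpha> f < \<infinity>" using f by (simp add: bergman_space_iff)
  then have "ennreal (K powr p) * bergman_mass p \<alpha> f < \<infinity>"
    by (simp add: ennreal_mult_less_top)
  then show ?thesis
    using bergman_mass_T_le[OF f] T_holomorphic[OF f] by (simp add: bergman_space_iff)
qed

lemma bergman_norm_T_le:
  assumes f: "f \<in> bergman_space p \<alpha>"
  shows "bergman_norm p \<alpha> (T f) \<le> K * bergman_norm p \<alpha> f"
proof -
  have fin: "bergman_mass p \<alpha> f < \<infinity>" using f by (simp add: bergman_space_iff)
  have "enn2real (bergman_mass p \<alpha> (T f)) \<le> enn2real (ennreal (K powr p) * bergman_mass p \<alpha> f)"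
    using bergman_mass_T_le[OF f] fin by (intro enn2real_mono) (auto simp: ennreal_mult_less_top)
  then have "enn2real (bergman_mass p \<alpha> (T f)) powr (1 / p)
      \<le> (K powr p * enn2real (bergman_mass p \<alpha> f)) powr (1 / p)"
    using p by (intro powr_mono2) (auto simp: enn2real_mult)
  also have "\<dots> = K * enn2real (bergman_mass p \<alpha> f) powr (1 / p)"
    using p K_nonneg by (simp add: powr_mult powr_powr)
  finally show ?thesis
    by (simp add: bergman_norm_eq[OF f] bergman_norm_eq[OF T_bergman_space[OF f]])
qed

end

end

section \<open>Test functions\<close>

lemma nn_integral_powr_from_0:
  fixes a :: real
  assumes "a > -1" "0 < c"
  shows "(\<integral>\<^sup>+x\<in>{0..c}. ennreal (x powr a) \<partial>lborel) = ennreal (c powr (a + 1) / (a + 1))"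
  using assms by (intro nn_integral_has_integral_lebesgue' has_integral_powr_from_0) auto

lemma nn_integral_powr_at_top:
  fixes e :: real
  assumes "e < -1" "0 < c"
  shows "(\<integral>\<^sup>+x\<in>{c..}. ennreal (x powr e) \<partial>lborel) = ennreal (- (c powr (e + 1)) / (e + 1))"
  using assms by (intro nn_integral_has_integral_lebesgue' has_integral_powr_to_inf) auto

text \<open>With s = \<beta> * p, this and \<open>height_mass\<close> are the factors of the mass of
  a test function in the coordinates u = x / (1 + y) and y. As s decreases to 1 + \<alpha>, this
  factor stays bounded and the other one blows up.\<close>

definition kernel_mass :: "real set \<Rightarrow> real \<Rightarrow> ennreal" where
  "kernel_mass A s = (\<integral>\<^sup>+u\<in>A. ennreal ((1 + u\<^sup>2) powr (- s / 2)) \<partial>lborel)"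

definition height_mass :: "real \<Rightarrow> real \<Rightarrow> ennreal" where
  "height_mass \<alpha> s = (\<integral>\<^sup>+y\<in>{0<..}. ennreal ((1 + y) powr (1 - s) * y powr (\<alpha> - 1)) \<partial>lborel)"

text \<open>The principal power (1 - i z) powr -\<beta>. Since 1 - i z has positive real part on the
  half-plane, the branch cut is avoided.\<close>

definition test_fun :: "real \<Rightarrow> complex \<Rightarrow> complex" where
  "test_fun \<beta> z = exp (- of_real \<beta> * Ln (1 - \<i> * z))"

lemma test_fun_arg_Re_pos: "z \<in> upper_half_plane \<Longrightarrow> 0 < Re (1 - \<i> * z)"
  by (simp add: upper_half_plane_def)

lemma test_fun_arg_ne_0: "z \<in> upper_half_plane \<Longrightarrow> 1 - \<i> * z \<noteq> 0"
  using test_fun_arg_Re_pos[of z] by force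

lemma test_fun_holomorphic: "test_fun \<beta> holomorphic_on upper_half_plane"
proof -
  have "1 - \<i> * z \<notin> \<real>\<^sub>\<le>\<^sub>0" if "z \<in> upper_half_plane" for z
    using test_fun_arg_Re_pos[OF that] by (auto simp: complex_nonpos_Reals_iff)
  then show ?thesis
    unfolding test_fun_def[abs_def] by (intro holomorphic_intros) auto
qed

lemma cmod_test_fun:
  "z \<in> upper_half_plane \<Longrightarrow> cmod (test_fun \<beta> z) = cmod (1 - \<i> * z) powr - \<beta>"
  using test_fun_arg_ne_0[of z] by (simp add: test_fun_def norm_exp_eq_Re powr_def)

lemma one_le_cmod_test_arg: "z \<in> upper_half_plane \<Longrightarrow> 1 \<le> cmod (1 - \<i> * z)"
  using abs_Re_le_cmod[of "1 - \<i> * z"] by (simp add: upper_half_plane_def)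

text \<open>Adding t >= 0 to -i z, whose real part Im z is positive, moves it away from the
  origin.\<close>

lemma cmod_le_cmod_test_arg:
  assumes "z \<in> upper_half_plane" "0 \<le> t"
  shows "cmod z \<le> cmod (of_real t - \<i> * z)"
proof -
  have "(Im z)\<^sup>2 \<le> (t + Im z)\<^sup>2"
    using assms by (intro power_mono) (auto simp: upper_half_plane_def)
  then show ?thesis by (simp add: cmod_def)
qed

lemma cmod_test_fun_le_1: "z \<in> upper_half_plane \<Longrightarrow> 0 \<le> \<beta> \<Longrightarrow> cmod (test_fun \<beta> z) \<le> 1"
  using one_le_cmod_test_arg[of z] powr_mono[of "- \<beta>" 0 "cmod (1 - \<i> * z)"] test_fun_arg_ne_0[of z]
  by (simp add: cmod_test_fun)

text \<open>Substituting \<open>x = (1 + y) u\<close> turns the integral over a sector into a product.\<close>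

lemma test_fun_sector_mass:
  assumes A [measurable]: "A \<in> sets borel"
  shows "(\<integral>\<^sup>+z\<in>{z. 0 < Im z \<and> Re z / (1 + Im z) \<in> A}.
            ennreal (cmod (test_fun \<beta> z) powr p * Im z powr (\<alpha> - 1)) \<partial>lborel)
    = kernel_mass A (\<beta> * p) * height_mass \<alpha> (\<beta> * p)"
proof -
  define s where "s = \<beta> * p"
  define H where "H x y = ennreal (((1 + y)\<^sup>2 + x\<^sup>2) powr (- s / 2) * y powr (\<alpha> - 1))
      * indicator {0<..} y * indicator A (x / (1 + y))" for x y :: real
  have Hm [measurable]: "(\<lambda>z. H (Re z) (Im z)) \<in> borel_measurable borel"
    unfolding H_def by measurable
  have eq: "ennreal (cmod (test_fun \<beta> z) powr p * Im z powr (\<alpha> - 1))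
      * indicator {z. 0 < Im z \<and> Re z / (1 + Im z) \<in> A} z = H (Re z) (Im z)" for z
  proof (cases "0 < Im z")
    case True
    have "cmod (1 - \<i> * z) = ((1 + Im z)\<^sup>2 + (Re z)\<^sup>2) powr (1 / 2)"
      by (simp add: cmod_def powr_half_sqrt)
    then have "cmod (test_fun \<beta> z) powr p = ((1 + Im z)\<^sup>2 + (Re z)\<^sup>2) powr (- s / 2)"
      using True by (simp add: cmod_test_fun upper_half_plane_def powr_powr s_def)
    then show ?thesis using True by (simp add: H_def indicator_def)
  qed (simp add: H_def)
  have inner: "(\<integral>\<^sup>+x. H x y \<partial>lborel)
      = kernel_mass A s * (ennreal ((1 + y) powr (1 - s) * y powr (\<alpha> - 1)) * indicator {0<..} y)" for y
  proof (cases "0 < y")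
    case True
    have [measurable]: "(\<lambda>x. H x y) \<in> borel_measurable borel"
      unfolding H_def by measurable
    have *: "H (0 + (1 + y) * u) y = ennreal ((1 + y) powr (- s) * y powr (\<alpha> - 1)) *
        (ennreal ((1 + u\<^sup>2) powr (- s / 2)) * indicator A u)" for u
    proof -
      have "(1 + y)\<^sup>2 + ((1 + y) * u)\<^sup>2 = (1 + y)\<^sup>2 * (1 + u\<^sup>2)"
        by (simp add: algebra_simps power2_eq_square)
      moreover have "((1 + y)\<^sup>2) powr (- s / 2) = (1 + y) powr - s"
        using True by (simp add: powr_powr flip: powr_numeral)
      ultimately have "((1 + y)\<^sup>2 + ((1 + y) * u)\<^sup>2) powr (- s / 2) = (1 + y) powr - s * (1 + u\<^sup>2) powr (- s / 2)"
        by (simp add: powr_mult)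
      then show ?thesis
        using True by (simp add: H_def mult_ac ennreal_mult)
    qed
    have "(\<integral>\<^sup>+x. H x y \<partial>lborel) = ennreal \<bar>1 + y\<bar> * (\<integral>\<^sup>+u. H (0 + (1 + y) * u) y \<partial>lborel)"
      using True by (intro nn_integral_real_affine) auto
    also have "\<dots> = ennreal ((1 + y) * ((1 + y) powr (- s) * y powr (\<alpha> - 1))) * kernel_mass A s"
      unfolding * kernel_mass_def using True
      by (subst nn_integral_cmult) (auto simp: ennreal_mult mult.assoc)
    also have "(1 + y) * ((1 + y) powr (- s) * y powr (\<alpha> - 1)) = (1 + y) powr (1 - s) * y powr (\<alpha> - 1)"
      using True powr_mult_base[of "1 + y" "- s"] by simp
    finally show ?thesis using True by (simp add: mult.commute)
  qed (simp add: H_def)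
  have "(\<integral>\<^sup>+z. H (Re z) (Im z) \<partial>lborel) = (\<integral>\<^sup>+y. \<integral>\<^sup>+x. H x y \<partial>lborel \<partial>lborel)"
    by (subst nn_integral_lborel_complex(2)) auto
  also have "\<dots> = kernel_mass A s * height_mass \<alpha> s"
    unfolding inner height_mass_def by (intro nn_integral_cmult) measurable
  finally show ?thesis by (simp add: eq s_def)
qed

lemma bergman_mass_test_fun:
  "bergman_mass p \<alpha> (test_fun \<beta>) = kernel_mass UNIV (\<beta> * p) * height_mass \<alpha> (\<beta> * p)"
  using test_fun_sector_mass[of UNIV \<beta> p \<alpha>] by (simp add: bergman_mass_def upper_half_plane_def)

lemma kernel_mass_finite:
  assumes s: "1 < s"
  shows "kernel_mass UNIV s < \<infinity>"
proof -
  define g where "g u = ennreal (u powr - s) * indicator {1..} u" for u :: real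
  have [measurable]: "g \<in> borel_measurable borel" unfolding g_def by measurable
  have g: "(\<integral>\<^sup>+u. g u \<partial>lborel) < \<infinity>"
    using s by (simp add: g_def nn_integral_powr_at_top)
  have g': "(\<integral>\<^sup>+u. g (- u) \<partial>lborel) < \<infinity>"
    using g by (subst (asm) nn_integral_real_affine[of g "-1" 0]) auto
  have "kernel_mass UNIV s \<le> (\<integral>\<^sup>+u. indicator {-1..1} u + (g u + g (- u)) \<partial>lborel)"
    unfolding kernel_mass_def
  proof (intro nn_integral_mono)
    fix u :: real
    have le1: "(1 + u\<^sup>2) powr (- s / 2) \<le> 1"
      using powr_mono[of "- s / 2" 0 "1 + u\<^sup>2"] s by (simp add: add_nonneg_eq_0_iff)
    have le2: "(1 + u\<^sup>2) powr (- s / 2) \<le> \<bar>u\<bar> powr - s" if "u \<noteq> 0"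
    proof -
      have "(1 + u\<^sup>2) powr (- s / 2) \<le> (\<bar>u\<bar>\<^sup>2) powr (- s / 2)"
        using that s by (intro powr_mono2') auto
      also have "\<dots> = \<bar>u\<bar> powr - s"
        using that by (simp add: powr_powr flip: powr_numeral del: power2_abs)
      finally show ?thesis .
    qed
    consider "u \<in> {-1..1}" | "1 < u" | "u < -1" by fastforce
    then show "ennreal ((1 + u\<^sup>2) powr (- s / 2)) * indicator UNIV u \<le> indicator {-1..1} u + (g u + g (- u))"
    proof cases
      case 1
      have "ennreal ((1 + u\<^sup>2) powr (- s / 2)) \<le> 1 + (g u + g (- u))"
        using ennreal_leI[OF le1] by (intro add_increasing2) auto
      then show ?thesis using 1 by simp
    qed (use le2 in \<open>auto simp: g_def intro!: ennreal_leI\<close>)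
  qed
  also have "\<dots> < \<infinity>"
    using g g' by (subst nn_integral_add; simp)+
  finally show ?thesis .
qed

lemma kernel_mass_antimono: "s \<le> s' \<Longrightarrow> kernel_mass A s' \<le> kernel_mass A s"
  unfolding kernel_mass_def
  by (intro nn_integral_mono mult_right_mono ennreal_leI powr_mono) auto

lemma kernel_mass_interval_ge:
  assumes c: "0 \<le> c" and s: "0 \<le> s"
  shows "ennreal (2 * c * (1 + c\<^sup>2) powr (- s / 2)) \<le> kernel_mass {-c..c} s"
proof -
  have "ennreal (2 * c * (1 + c\<^sup>2) powr (- s / 2))
      = (\<integral>\<^sup>+u. ennreal ((1 + c\<^sup>2) powr (- s / 2)) * indicator {-c..c} u \<partial>lborel)"
    using c by (subst nn_integral_cmult_indicator) (auto simp: ennreal_mult mult.commute)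
  also have "\<dots> \<le> kernel_mass {-c..c} s"
    unfolding kernel_mass_def
  proof (intro nn_integral_mono)
    fix u :: real
    have "u\<^sup>2 \<le> c\<^sup>2" if "u \<in> {-c..c}"
      using that c by (intro power2_le_iff_abs_le[THEN iffD2]) auto
    then show "ennreal ((1 + c\<^sup>2) powr (- s / 2)) * indicator {-c..c} u
        \<le> ennreal ((1 + u\<^sup>2) powr (- s / 2)) * indicator {-c..c} u"
      using s by (auto simp: indicator_def add_nonneg_eq_0_iff intro!: ennreal_leI powr_mono2' add_pos_nonneg)
  qed
  finally show ?thesis .
qed

text \<open>The weight is integrable at 0 because \<alpha> > 0; at infinity the integrand is
  dominated by y powr (\<alpha> - s), integrable because s > 1 + \<alpha>.\<close>

lemma height_mass_finite:
  assumes \<alpha>: "0 < \<alpha>" and s: "1 + \<alpha> < s"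
  shows "height_mass \<alpha> s < \<infinity>"
proof -
  have "height_mass \<alpha> s \<le> (\<integral>\<^sup>+y. ennreal (y powr (\<alpha> - 1)) * indicator {0..1} y
      + ennreal (y powr (\<alpha> - s)) * indicator {1..} y \<partial>lborel)"
    unfolding height_mass_def
  proof (intro nn_integral_mono)
    fix y :: real
    show "ennreal ((1 + y) powr (1 - s) * y powr (\<alpha> - 1)) * indicator {0<..} y
      \<le> ennreal (y powr (\<alpha> - 1)) * indicator {0..1} y + ennreal (y powr (\<alpha> - s)) * indicator {1..} y"
    proof (cases "0 < y")
      case True
      have "(1 + y) powr (1 - s) * y powr (\<alpha> - 1) \<le> 1 * y powr (\<alpha> - 1)"
        using powr_mono[of "1 - s" 0 "1 + y"] s \<alpha> True by (intro mult_right_mono) auto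
      moreover have "(1 + y) powr (1 - s) * y powr (\<alpha> - 1) \<le> y powr (1 - s) * y powr (\<alpha> - 1)"
        using s \<alpha> True by (intro mult_right_mono powr_mono2') auto
      moreover have "y powr (1 - s) * y powr (\<alpha> - 1) = y powr (\<alpha> - s)"
        by (simp flip: powr_add)
      ultimately show ?thesis
        using True by (cases "y \<le> 1") (auto intro!: ennreal_leI add_increasing2)
    qed simp
  qed
  also have "\<dots> < \<infinity>"
    using \<alpha> s by (subst nn_integral_add) (auto simp: nn_integral_powr_from_0 nn_integral_powr_at_top)
  finally show ?thesis .
qed

text \<open>For y >= 1 one has 1 + y <= 2 * y, which leaves the integral of y powr (-1 - e) over
  {1..}, that is 1 / e. This is the source of the blow-up of the test functions.\<close>

lemma height_mass_ge:
  assumes \<alpha>: "0 < \<alpha>" and e: "0 < e"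
  shows "ennreal (2 powr (- \<alpha> - e) / e) \<le> height_mass \<alpha> (1 + \<alpha> + e)"
proof -
  have "ennreal (2 powr (- \<alpha> - e) / e) = ennreal (2 powr (- \<alpha> - e)) * ennreal (1 / e)"
    using e by (subst ennreal_mult[symmetric]) auto
  also have "\<dots> = ennreal (2 powr (- \<alpha> - e)) * (\<integral>\<^sup>+y. ennreal (y powr (- 1 - e)) * indicator {1..} y \<partial>lborel)"
  proof -
    have "- (1 powr ((- 1 - e) + 1)) / ((- 1 - e) + 1) = 1 / e" by simp
    then show ?thesis using e by (subst nn_integral_powr_at_top) auto
  qed
  also have "\<dots> = (\<integral>\<^sup>+y. ennreal (2 powr (- \<alpha> - e)) * (ennreal (y powr (- 1 - e)) * indicator {1..} y) \<partial>lborel)"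
    by (intro nn_integral_cmult[symmetric]) measurable
  also have "\<dots> \<le> height_mass \<alpha> (1 + \<alpha> + e)"
    unfolding height_mass_def
  proof (intro nn_integral_mono)
    fix y :: real
    have "2 powr (- \<alpha> - e) * y powr (- 1 - e) \<le> (1 + y) powr (1 - (1 + \<alpha> + e)) * y powr (\<alpha> - 1)"
      if y: "1 \<le> y"
    proof -
      have "2 powr (- \<alpha> - e) * y powr (- 1 - e) = (2 * y) powr (- \<alpha> - e) * y powr (\<alpha> - 1)"
      proof -
        have "y powr (- \<alpha> - e) * y powr (\<alpha> - 1) = y powr (- 1 - e)"
          by (subst powr_add[symmetric]) (simp add: algebra_simps)
        then show ?thesis using y by (simp add: powr_mult mult.assoc)
      qed
      also have "\<dots> \<le> (1 + y) powr (- \<alpha> - e) * y powr (\<alpha> - 1)"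
        using y \<alpha> e by (intro mult_right_mono powr_mono2') auto
      finally show ?thesis by simp
    qed
    then show "ennreal (2 powr (- \<alpha> - e)) * (ennreal (y powr (- 1 - e)) * indicator {1..} y)
      \<le> ennreal ((1 + y) powr (1 - (1 + \<alpha> + e)) * y powr (\<alpha> - 1)) * indicator {0<..} y"
      by (auto simp: indicator_def simp flip: ennreal_mult intro!: ennreal_leI)
  qed
  finally show ?thesis .
qed

text \<open>As the test functions are bounded by 1, this bounds their mass on a fixed box
  independently of e.\<close>

lemma weight_on_box_finite:
  assumes \<alpha>: "0 < \<alpha>" and R: "0 < R"
  shows "(\<integral>\<^sup>+z\<in>{z. 0 < Im z \<and> Im z \<le> R \<and> \<bar>Re z\<bar> \<le> R}. ennreal (Im z powr (\<alpha> - 1)) \<partial>lborel) < \<infinity>"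
proof -
  have "(\<integral>\<^sup>+z\<in>{z. 0 < Im z \<and> Im z \<le> R \<and> \<bar>Re z\<bar> \<le> R}. ennreal (Im z powr (\<alpha> - 1)) \<partial>lborel)
      \<le> (\<integral>\<^sup>+z. (ennreal (Im z powr (\<alpha> - 1)) * indicator {0..R} (Im z)) * indicator {-R..R} (Re z) \<partial>lborel)"
    by (intro nn_integral_mono) (auto simp: indicator_def)
  also have "\<dots> = (\<integral>\<^sup>+y. (ennreal (y powr (\<alpha> - 1)) * indicator {0..R} y) * ennreal (2 * R) \<partial>lborel)"
    using R by (subst nn_integral_lborel_complex(2)) (auto intro!: nn_integral_cong simp: nn_integral_cmult_indicator)
  also have "\<dots> < \<infinity>"
    using \<alpha> R by (simp add: nn_integral_multc nn_integral_powr_from_0 ennreal_mult_less_top)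
  finally show ?thesis .
qed

section \<open>Logarithm and argument of the test functions\<close>

lemma cmod_Ln_diff_le:
  assumes m: "0 < m" and seg: "\<And>\<zeta>. \<zeta> \<in> closed_segment u v \<Longrightarrow> 0 < Re \<zeta> \<and> m \<le> cmod \<zeta>"
  shows "cmod (Ln u - Ln v) \<le> cmod (u - v) / m"
proof -
  have "cmod (Ln u - Ln v) \<le> (1 / m) * cmod (u - v)"
  proof (rule field_differentiable_bound[of "closed_segment u v" Ln inverse])
    fix \<zeta> assume \<zeta>: "\<zeta> \<in> closed_segment u v"
    then have "0 < Re \<zeta>" "m \<le> cmod \<zeta>" using seg by auto
    then show "(Ln has_field_derivative inverse \<zeta>) (at \<zeta> within closed_segment u v)"
      by (intro has_field_derivative_at_within[OF has_field_derivative_Ln]) (auto simp: complex_nonpos_Reals_iff)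
    show "cmod (inverse \<zeta>) \<le> 1 / m"
      using \<open>m \<le> cmod \<zeta>\<close> m by (simp add: norm_inverse le_imp_inverse_le flip: inverse_eq_divide)
  qed auto
  then show ?thesis by simp
qed

text \<open>Compares v with its real part, where Ln is real; on the vertical segment between them
  the modulus is at least Re v.\<close>

lemma abs_Im_Ln_le:
  assumes v: "0 < Re v"
  shows "\<bar>Im (Ln v)\<bar> \<le> \<bar>Im v\<bar> / Re v"
proof -
  have "cmod (Ln v - Ln (of_real (Re v))) \<le> cmod (v - of_real (Re v)) / Re v"
  proof (rule cmod_Ln_diff_le[OF v])
    fix \<zeta> assume "\<zeta> \<in> closed_segment v (of_real (Re v))"
    then obtain u where "\<zeta> = (1 - u) *\<^sub>R v + u *\<^sub>R of_real (Re v)"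
      by (auto simp: closed_segment_def)
    then have "Re \<zeta> = (1 - u) * Re v + u * Re v" by simp
    then have "Re \<zeta> = Re v" by (simp add: algebra_simps)
    then show "0 < Re \<zeta> \<and> Re v \<le> cmod \<zeta>"
      using v complex_Re_le_cmod[of \<zeta>] by simp
  qed
  moreover have "\<bar>Im (Ln v)\<bar> \<le> cmod (Ln v - Ln (of_real (Re v)))"
    using abs_Im_le_cmod[of "Ln v - Ln (of_real (Re v))"] v by (simp add: Ln_of_real)
  moreover have "cmod (v - of_real (Re v)) = \<bar>Im v\<bar>"
    by (simp add: cmod_def)
  ultimately show ?thesis by simp
qed

lemma cos_ge_half:
  fixes x :: real
  assumes "\<bar>x\<bar> \<le> 1" shows "1 / 2 \<le> cos x"
proof -
  have "cos (pi / 3) \<le> cos \<bar>x\<bar>"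
    using assms pi_gt3 by (intro cos_monotone_0_pi_le) auto
  then show ?thesis by (simp add: cos_60)
qed

text \<open>The argument of the value is -\<beta> times that of 1 - i z, and the latter is at most
  |Re z| / (1 + Im z). The hypothesis keeps it within 1 < pi / 3, where the cosine is at least 1 /
  2.\<close>

lemma Re_test_fun_ge:
  assumes z: "z \<in> upper_half_plane" and \<beta>: "0 \<le> \<beta>" and x: "\<beta> * (\<bar>Re z\<bar> / (1 + Im z)) \<le> 1"
  shows "cmod (test_fun \<beta> z) / 2 \<le> Re (test_fun \<beta> z)"
proof -
  define v where "v = 1 - \<i> * z"
  have v: "Re v = 1 + Im z" "Im v = - Re z" "0 < Re v"
    using z by (auto simp: v_def upper_half_plane_def)
  have "\<beta> * \<bar>Im (Ln v)\<bar> \<le> \<beta> * (\<bar>Im v\<bar> / Re v)"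
    using abs_Im_Ln_le[OF v(3)] \<beta> by (intro mult_left_mono)
  also have "\<dots> = \<beta> * (\<bar>Re z\<bar> / (1 + Im z))"
    by (simp only: v abs_minus_cancel)
  finally have "\<beta> * \<bar>Im (Ln v)\<bar> \<le> 1" using x by linarith
  then have "\<bar>- \<beta> * Im (Ln v)\<bar> \<le> 1"
    using \<beta> by (simp only: abs_mult abs_minus_cancel abs_of_nonneg)
  then have "1 / 2 \<le> cos (- \<beta> * Im (Ln v))" by (rule cos_ge_half)
  then have "exp (- \<beta> * Re (Ln v)) * (1 / 2) \<le> exp (- \<beta> * Re (Ln v)) * cos (- \<beta> * Im (Ln v))"
    by (intro mult_left_mono) auto
  moreover have "cmod (test_fun \<beta> z) = exp (- \<beta> * Re (Ln v))"
    "Re (test_fun \<beta> z) = exp (- \<beta> * Re (Ln v)) * cos (- \<beta> * Im (Ln v))"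
    by (simp_all add: test_fun_def norm_exp_eq_Re Re_exp flip: v_def)
  ultimately show ?thesis by simp
qed

text \<open>Plays the part of Minkowski's inequality: l near 0 keeps the factor of f near 1 at the
  price of a large factor for g, which is affordable when g has small relative mass.\<close>

lemma bergman_mass_add_le:
  assumes p: "1 \<le> p" and l: "0 < l" "l < 1"
    and f: "continuous_on upper_half_plane f" and g: "continuous_on upper_half_plane g"
    and h: "\<And>z. z \<in> upper_half_plane \<Longrightarrow> cmod (h z) \<le> cmod (f z) + cmod (g z)"
  shows "bergman_mass p \<alpha> h \<le> ennreal ((1 - l) powr (1 - p)) * bergman_mass p \<alpha> f
      + ennreal (l powr (1 - p)) * bergman_mass p \<alpha> g"
proof -
  note [measurable] = bergman_density_measurable[OF f, of p \<alpha>] bergman_density_measurable[OF g, of p \<alpha>]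
  have "bergman_mass p \<alpha> h \<le> (\<integral>\<^sup>+z.
      ennreal ((1 - l) powr (1 - p)) * (ennreal (cmod (f z) powr p * Im z powr (\<alpha> - 1)) * indicator upper_half_plane z)
      + ennreal (l powr (1 - p)) * (ennreal (cmod (g z) powr p * Im z powr (\<alpha> - 1)) * indicator upper_half_plane z) \<partial>lborel)"
    unfolding bergman_mass_def
  proof (intro nn_integral_mono)
    fix z
    have "cmod (h z) powr p \<le> (1 - l) powr (1 - p) * cmod (f z) powr p + l powr (1 - p) * cmod (g z) powr p"
      if "z \<in> upper_half_plane"
      using p l h[OF that] by (intro order_trans[OF powr_mono2[of p "cmod (h z)"] powr_add_le_split]) auto
    then have "cmod (h z) powr p * Im z powr (\<alpha> - 1)
        \<le> ((1 - l) powr (1 - p) * cmod (f z) powr p + l powr (1 - p) * cmod (g z) powr p) * Im z powr (\<alpha> - 1)"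
      if "z \<in> upper_half_plane"
      using that by (intro mult_right_mono) auto
    then show "ennreal (cmod (h z) powr p * Im z powr (\<alpha> - 1)) * indicator upper_half_plane z
      \<le> ennreal ((1 - l) powr (1 - p)) * (ennreal (cmod (f z) powr p * Im z powr (\<alpha> - 1)) * indicator upper_half_plane z)
      + ennreal (l powr (1 - p)) * (ennreal (cmod (g z) powr p * Im z powr (\<alpha> - 1)) * indicator upper_half_plane z)"
      by (auto simp: indicator_def distrib_right mult.assoc simp flip: ennreal_mult ennreal_plus intro!: ennreal_leI)
  qed
  also have "\<dots> = ennreal ((1 - l) powr (1 - p)) * bergman_mass p \<alpha> f
      + ennreal (l powr (1 - p)) * bergman_mass p \<alpha> g"
    unfolding bergman_mass_def by (subst nn_integral_add; simp add: nn_integral_cmult)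
  finally show ?thesis .
qed

section \<open>Masses of the test functions near the critical exponent\<close>

context hausdorff_kernel
begin

lemma test_fun_exponent: "(b + e) * p = 1 + \<alpha> + e * p"
  by (simp add: distrib_right bp)

lemma test_fun_bergman:
  assumes "0 < e"
  shows "test_fun (b + e) \<in> bergman_space p \<alpha>"
proof -
  have "1 + \<alpha> < 1 + \<alpha> + e * p" using assms p by simp
  then have "kernel_mass UNIV (1 + \<alpha> + e * p) < \<infinity>" "height_mass \<alpha> (1 + \<alpha> + e * p) < \<infinity>"
    using \<alpha> by (intro kernel_mass_finite height_mass_finite; linarith)+
  then show ?thesis
    by (simp add: bergman_space_iff test_fun_holomorphic bergman_mass_test_fun test_fun_exponent
        ennreal_mult_less_top)
qed

lemma test_fun_mass_lower:
  obtains c where "0 < c" "\<And>e. 0 < e \<Longrightarrow> e \<le> 1 \<Longrightarrow> ennreal (c / e) \<le> bergman_mass p \<alpha> (test_fun (b + e))"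
proof -
  \<comment> \<open>The lower bounds for the two factors of the mass, with e * p replaced by its
    largest value p in the exponents and 1 / e split off.\<close>
  define c where "c = 2 * 2 powr (- (1 + \<alpha> + p) / 2) * (2 powr (- \<alpha> - p) / p)"
  have "ennreal (c / e) \<le> bergman_mass p \<alpha> (test_fun (b + e))" if e: "0 < e" "e \<le> 1" for e
  proof -
    define s where "s = 1 + \<alpha> + e * p"
    have ep: "e * p \<le> p" "0 < e * p" using e p by auto
    have "ennreal (2 * 2 powr (- (1 + \<alpha> + p) / 2)) \<le> ennreal (2 * 1 * (1 + 1\<^sup>2) powr (- s / 2))"
      using ep by (intro ennreal_leI) (auto simp: s_def intro!: powr_mono)
    also have "\<dots> \<le> kernel_mass {-1..1} s"
      using \<alpha> ep by (intro kernel_mass_interval_ge) (auto simp: s_def)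
    also have "\<dots> \<le> kernel_mass UNIV s"
      unfolding kernel_mass_def by (intro nn_integral_mono) (auto simp: indicator_def)
    finally have 1: "ennreal (2 * 2 powr (- (1 + \<alpha> + p) / 2)) \<le> kernel_mass UNIV s" .
    have "ennreal (2 powr (- \<alpha> - p) / (e * p)) \<le> ennreal (2 powr (- \<alpha> - e * p) / (e * p))"
      using ep by (intro ennreal_leI divide_right_mono powr_mono) auto
    also have "\<dots> \<le> height_mass \<alpha> s"
      unfolding s_def by (rule height_mass_ge[OF \<alpha> ep(2)])
    finally have 2: "ennreal (2 powr (- \<alpha> - p) / (e * p)) \<le> height_mass \<alpha> s" .
    have "c / e = 2 * 2 powr (- (1 + \<alpha> + p) / 2) * (2 powr (- \<alpha> - p) / (e * p))"
      using e by (simp add: c_def field_simps)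
    then have "ennreal (c / e) = ennreal (2 * 2 powr (- (1 + \<alpha> + p) / 2)) * ennreal (2 powr (- \<alpha> - p) / (e * p))"
      using ep by (subst ennreal_mult[symmetric]) auto
    also have "\<dots> \<le> kernel_mass UNIV s * height_mass \<alpha> s"
      by (intro mult_mono 1 2) auto
    finally show ?thesis by (simp add: bergman_mass_test_fun test_fun_exponent s_def)
  qed
  moreover have "0 < c" using p by (simp add: c_def)
  ultimately show ?thesis using that by blast
qed

text \<open>The mass of the sector and the total mass share the factor \<open>height_mass\<close>,
  so their ratio depends on \<open>kernel_mass\<close> alone, which stays bounded above and away
  from 0 for e <= 1.\<close>

lemma test_fun_sector_lower:
  assumes \<kappa>: "0 < \<kappa>"
  obtains c where "0 < c" "\<And>e. 0 < e \<Longrightarrow> e \<le> 1 \<Longrightarrow>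
    ennreal c * bergman_mass p \<alpha> (test_fun (b + e)) \<le>
      (\<integral>\<^sup>+z\<in>{z. 0 < Im z \<and> Re z / (1 + Im z) \<in> {-\<kappa>..\<kappa>}}.
            ennreal (cmod (test_fun (b + e) z) powr p * Im z powr (\<alpha> - 1)) \<partial>lborel)"
proof -
  have "kernel_mass UNIV (1 + \<alpha>) < \<infinity>" using \<alpha> by (intro kernel_mass_finite) auto
  then obtain B0 where B0: "0 \<le> B0" "kernel_mass UNIV (1 + \<alpha>) = ennreal B0"
    by (cases "kernel_mass UNIV (1 + \<alpha>)") auto
  \<comment> \<open>The added 1 makes the divisor B positive.\<close>
  define B where "B = B0 + 1"
  have B: "0 < B" "kernel_mass UNIV (1 + \<alpha>) \<le> ennreal B"
    using B0 by (auto simp: B_def intro!: ennreal_leI)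
  define q where "q = 2 * \<kappa> * (1 + \<kappa>\<^sup>2) powr (- (1 + \<alpha> + p) / 2)"
  have q: "0 < q"
    using \<kappa> by (simp add: q_def add_pos_nonneg add_nonneg_eq_0_iff)
  have "ennreal (q / B) * bergman_mass p \<alpha> (test_fun (b + e)) \<le>
      (\<integral>\<^sup>+z\<in>{z. 0 < Im z \<and> Re z / (1 + Im z) \<in> {-\<kappa>..\<kappa>}}.
            ennreal (cmod (test_fun (b + e) z) powr p * Im z powr (\<alpha> - 1)) \<partial>lborel)"
    if e: "0 < e" "e \<le> 1" for e
  proof -
    define s where "s = 1 + \<alpha> + e * p"
    have ep: "e * p \<le> p" "0 < e * p" using e p by auto
    have "kernel_mass UNIV s \<le> kernel_mass UNIV (1 + \<alpha>)"
      using ep by (intro kernel_mass_antimono) (simp add: s_def)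
    then have "ennreal (q / B) * kernel_mass UNIV s \<le> ennreal (q / B) * ennreal B"
      using B(2) by (intro mult_left_mono order_trans[OF _ B(2)]) auto
    also have "\<dots> = ennreal q"
      using B(1) q by (simp flip: ennreal_mult)
    also have "\<dots> \<le> ennreal (2 * \<kappa> * (1 + \<kappa>\<^sup>2) powr (- s / 2))"
      unfolding q_def using \<kappa> ep
      by (intro ennreal_leI mult_left_mono powr_mono) (auto simp: s_def)
    also have "\<dots> \<le> kernel_mass {-\<kappa>..\<kappa>} s"
      using \<kappa> \<alpha> ep by (intro kernel_mass_interval_ge) (auto simp: s_def)
    finally have "ennreal (q / B) * kernel_mass UNIV s * height_mass \<alpha> s
        \<le> kernel_mass {-\<kappa>..\<kappa>} s * height_mass \<alpha> s"
      by (intro mult_right_mono) auto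
    then show ?thesis
      by (subst test_fun_sector_mass) (auto simp: bergman_mass_test_fun test_fun_exponent s_def mult.assoc)
  qed
  moreover have "0 < q / B" using q B by simp
  ultimately show ?thesis using that by blast
qed

end

section \<open>Integrability of the kernel\<close>

context hausdorff_kernel
begin

text \<open>Dilation by t changes the slope |Re z| / (1 + Im z) into |Re z| / (t + Im z), which is
  at most |Re z| / Im z for all t. With Im z >= 1 and the opening 1 / (2 * (b + 1)) this is at most
  1 / (b + 1), and b + e <= b + 1 gives the bound 1 on the argument.\<close>

lemma Re_integrand_ge_sector:
  assumes e: "0 < e" "e \<le> 1" and z: "1 \<le> Im z" "\<bar>Re z\<bar> \<le> (1 + Im z) / (2 * (b + 1))"
  shows "cmod (hausdorff_integrand \<psi> (test_fun (b + e)) z t) / 2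
    \<le> Re (hausdorff_integrand \<psi> (test_fun (b + e)) z t)"
proof (cases "0 < t")
  case True
  have zt: "z / of_real t \<in> upper_half_plane"
    using True z by (simp add: upper_half_plane_def)
  have "\<bar>Re (z / of_real t)\<bar> / (1 + Im (z / of_real t)) = \<bar>Re z\<bar> / (t + Im z)"
    using True z by (simp add: field_simps abs_mult)
  also have "\<dots> \<le> ((1 + Im z) / (2 * (b + 1))) / Im z"
    using True z by (intro frac_le) auto
  also have "\<dots> = (1 + Im z) / (2 * Im z) * (1 / (b + 1))" by simp
  also have "\<dots> \<le> 1 / (b + 1)"
    using z b_pos by (intro mult_left_le_one_le) auto
  finally have "(b + e) * (\<bar>Re (z / of_real t)\<bar> / (1 + Im (z / of_real t))) \<le> (b + 1) * (1 / (b + 1))"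
    using e b_pos zt by (intro mult_mono) (auto simp: upper_half_plane_def)
  then have "(b + e) * (\<bar>Re (z / of_real t)\<bar> / (1 + Im (z / of_real t))) \<le> 1"
    using b_pos by simp
  then have "cmod (test_fun (b + e) (z / of_real t)) / 2 \<le> Re (test_fun (b + e) (z / of_real t))"
    using e b_pos by (intro Re_test_fun_ge zt) auto
  then have "cmod (test_fun (b + e) (z / of_real t)) / 2 * (\<psi> t / t)
      \<le> Re (test_fun (b + e) (z / of_real t)) * (\<psi> t / t)"
    using True \<psi>_nonneg by (intro mult_right_mono) auto
  moreover have "Re (hausdorff_integrand \<psi> (test_fun (b + e)) z t)
      = Re (test_fun (b + e) (z / of_real t)) * (\<psi> t / t)"
    unfolding hausdorff_integrand_def by (simp only: times_complex.sel Re_complex_of_real Im_complex_of_real mult_zero_right diff_zero)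
  moreover have "cmod (hausdorff_integrand \<psi> (test_fun (b + e)) z t)
      = cmod (test_fun (b + e) (z / of_real t)) * (\<psi> t / t)"
    unfolding hausdorff_integrand_def norm_mult norm_of_real using True \<psi>_nonneg[of t] by simp
  ultimately show ?thesis by simp
qed (simp add: hausdorff_integrand_def \<psi>_zero)

text \<open>For t <= R <= Im z one has |t - i z| <= 2 |z| <= 2 |1 - i z|, so the test function at z
  / t is at least a constant times t powr (b + e) times its value at z.\<close>

lemma cmod_integrand_ge:
  assumes e: "0 < e" "e * R \<le> 1" and R: "1 \<le> R" and z: "R \<le> Im z" and t: "t \<in> {1 / R..R}"
  shows "exp (- 1) * 2 powr (- b - e) * cmod (test_fun (b + e) z) * k t
    \<le> cmod (hausdorff_integrand \<psi> (test_fun (b + e)) z t)"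
proof -
  have R0: "0 < R" "0 < 1 / R" using R by auto
  have t0: "0 < t" "1 / R \<le> t" "t \<le> R" using t less_le_trans[OF R0(2), of t] by auto
  have zU: "z \<in> upper_half_plane" using z R by (simp add: upper_half_plane_def)
  have zt: "z / of_real t \<in> upper_half_plane"
    using t0 zU by (simp add: of_real_divide_mem_upper_half_plane)
  have "cmod (of_real t - \<i> * z) \<le> t + cmod z"
    using norm_triangle_ineq4[of "of_real t" "\<i> * z"] t0 by (simp add: norm_mult)
  also have "\<dots> \<le> 2 * cmod z"
    using t0 z abs_Im_le_cmod[of z] by linarith
  also have "\<dots> \<le> 2 * cmod (1 - \<i> * z)"
    using cmod_le_cmod_test_arg[OF zU, of 1] by simp
  finally have 1: "cmod (of_real t - \<i> * z) \<le> 2 * cmod (1 - \<i> * z)" .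
  have "1 - \<i> * (z / of_real t) = (of_real t - \<i> * z) / of_real t"
    using t0 by (simp add: field_simps)
  then have 2: "cmod (1 - \<i> * (z / of_real t)) = cmod (of_real t - \<i> * z) / t"
    using t0 by (simp add: norm_divide)
  have "(2 * cmod (1 - \<i> * z) / t) powr (- (b + e)) \<le> (cmod (of_real t - \<i> * z) / t) powr (- (b + e))"
    using 1 2 t0 test_fun_arg_ne_0[OF zt] e b_pos
    by (intro powr_mono2' divide_right_mono) (auto simp flip: 2)
  also have "\<dots> = cmod (test_fun (b + e) (z / of_real t))"
    by (simp only: cmod_test_fun[OF zt] 2)
  also have "(2 * cmod (1 - \<i> * z) / t) powr (- (b + e))
      = 2 powr (- b - e) * cmod (test_fun (b + e) z) * t powr (b + e)"
  proof -
    have "(2 * cmod (1 - \<i> * z) / t) powr (- (b + e))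
        = 2 powr (- (b + e)) * cmod (1 - \<i> * z) powr (- (b + e)) / t powr (- (b + e))"
      using t0 by (simp only: powr_divide powr_mult)
    also have "\<dots> = 2 powr (- (b + e)) * cmod (1 - \<i> * z) powr (- (b + e)) * t powr (b + e)"
      by (simp only: powr_minus divide_inverse inverse_inverse_eq)
    finally show ?thesis by (simp add: cmod_test_fun[OF zU])
  qed
  finally have A: "2 powr (- b - e) * cmod (test_fun (b + e) z) * t powr (b + e)
      \<le> cmod (test_fun (b + e) (z / of_real t))" .
  \<comment> \<open>The surplus factor t powr e is harmless: t >= 1 / R and e * ln R <= e * R <=
    1.\<close>
  have "exp (- 1) \<le> t powr e"
  proof -
    have "- ln R \<le> ln t"
      using t0 R0 ln_mono[of "1 / R" t] by (simp add: ln_div)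
    then have "e * (- ln R) \<le> e * ln t" using e by (intro mult_left_mono) auto
    moreover have "e * ln R \<le> e * R" using e R ln_le_minus_one[of R] by (intro mult_left_mono) auto
    ultimately have "- 1 \<le> e * ln t" using e by linarith
    then show ?thesis using t0 by (simp add: powr_def)
  qed
  then have "exp (- 1) * (2 powr (- b - e) * cmod (test_fun (b + e) z) * k t)
      \<le> t powr e * (2 powr (- b - e) * cmod (test_fun (b + e) z) * k t)"
    by (intro mult_right_mono) (auto simp: k_nonneg)
  also have "\<dots> = (2 powr (- b - e) * cmod (test_fun (b + e) z) * t powr (b + e)) * (\<psi> t / t)"
    using t0 by (simp add: k_def powr_add powr_diff)
  also have "\<dots> \<le> cmod (test_fun (b + e) (z / of_real t)) * (\<psi> t / t)"
    using A t0 \<psi>_nonneg by (intro mult_right_mono) auto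
  also have "\<dots> = cmod (hausdorff_integrand \<psi> (test_fun (b + e)) z t)"
    unfolding hausdorff_integrand_def norm_mult norm_of_real using t0 \<psi>_nonneg[of t] by simp
  finally show ?thesis by (simp add: mult.assoc)
qed

text \<open>The sector carries a fixed proportion of the mass of \<open>test_fun (b + e)\<close>, uniformly in \<open>e\<close>;
  \<open>e\<close> is taken so small, depending on \<open>R\<close>, that the part of the sector below height \<open>R\<close> is negligible.\<close>

lemma truncated_kernel_bound:
  assumes int: "\<And>f z. f \<in> bergman_space p \<alpha> \<Longrightarrow> z \<in> upper_half_plane \<Longrightarrow>
      integrable lborel (hausdorff_integrand \<psi> f z)"
    and S: "0 \<le> S" and bd: "\<And>f. f \<in> bergman_space p \<alpha> \<Longrightarrow>
      bergman_mass p \<alpha> (T f) \<le> ennreal S * bergman_mass p \<alpha> f"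
  obtains L where "\<And>R. 1 \<le> R \<Longrightarrow> (\<integral>\<^sup>+t\<in>{1 / R..R}. ennreal (k t) \<partial>lborel) \<le> ennreal L"
proof -
  define \<kappa> where "\<kappa> = 1 / (2 * (b + 1))"
  have \<kappa>: "0 < \<kappa>" using b_pos by (simp add: \<kappa>_def)
  define Sec where "Sec = {z. 0 < Im z \<and> Re z / (1 + Im z) \<in> {-\<kappa>..\<kappa>}}"
  define D where "D e z = ennreal (cmod (test_fun (b + e) z) powr p * Im z powr (\<alpha> - 1))" for e z
  obtain c where c: "0 < c" "\<And>e. 0 < e \<Longrightarrow> e \<le> 1 \<Longrightarrow>
      ennreal c * bergman_mass p \<alpha> (test_fun (b + e)) \<le> (\<integral>\<^sup>+z\<in>Sec. D e z \<partial>lborel)"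
    unfolding Sec_def D_def using test_fun_sector_lower[OF \<kappa>] by blast
  obtain c' where c': "0 < c'"
    "\<And>e. 0 < e \<Longrightarrow> e \<le> 1 \<Longrightarrow> ennreal (c' / e) \<le> bergman_mass p \<alpha> (test_fun (b + e))"
    using test_fun_mass_lower by blast
  \<comment> \<open>The constant of \<open>cmod_integrand_ge\<close> at the worst case e = 1, halved
    for the passage to the real part.\<close>
  define c0 where "c0 = exp (- 1) * 2 powr (- b - 1) / 2"
  have c0: "0 < c0" by (simp add: c0_def)
  \<comment> \<open>The solution of (c0 * L) powr p * (c / 2) = S; it does not involve R.\<close>
  define L where "L = (2 * S / c) powr (1 / p) / c0"
  have "(\<integral>\<^sup>+t\<in>{1 / R..R}. ennreal (k t) \<partial>lborel) \<le> ennreal L" if R: "1 \<le> R" for R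
  proof -
    define I where "I = (\<integral>\<^sup>+t\<in>{1 / R..R}. ennreal (k t) \<partial>lborel)"
    have lower: "ennreal (c0 * cmod (test_fun (b + e) z)) * I \<le> ennreal (cmod (T (test_fun (b + e)) z))"
      if e: "0 < e" "e \<le> 1" "e * R \<le> 1" and z: "z \<in> Sec" "R \<le> Im z" for e z
    proof -
      define f where "f = test_fun (b + e)"
      have fB: "f \<in> bergman_space p \<alpha>" unfolding f_def by (rule test_fun_bergman[OF e(1)])
      have zU: "z \<in> upper_half_plane" using z by (simp add: Sec_def upper_half_plane_def)
      have "\<bar>Re z / (1 + Im z)\<bar> \<le> \<kappa>"
        using z by (auto simp: Sec_def abs_le_iff)
      then have sec: "\<bar>Re z\<bar> \<le> (1 + Im z) / (2 * (b + 1))"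
        using z by (simp add: Sec_def \<kappa>_def field_simps)
      have Re_ge: "cmod (hausdorff_integrand \<psi> f z t) / 2 \<le> Re (hausdorff_integrand \<psi> f z t)" for t
        unfolding f_def using z R by (intro Re_integrand_ge_sector e sec) auto
      have Re0: "0 \<le> Re (hausdorff_integrand \<psi> f z t)" for t
        using Re_ge[of t] by (meson divide_nonneg_pos norm_ge_zero order_trans zero_less_numeral)
      note ii = int[OF fB zU]
      have "ennreal (c0 * cmod (f z)) * I = (\<integral>\<^sup>+t. ennreal (c0 * cmod (f z)) * (ennreal (k t) * indicator {1 / R..R} t) \<partial>lborel)"
        unfolding I_def by (intro nn_integral_cmult[symmetric]) measurable
      also have "\<dots> \<le> (\<integral>\<^sup>+t. ennreal (Re (hausdorff_integrand \<psi> f z t)) \<partial>lborel)"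
      proof (intro nn_integral_mono)
        fix t
        have "c0 * cmod (f z) * k t \<le> Re (hausdorff_integrand \<psi> f z t)" if t: "t \<in> {1 / R..R}"
        proof -
          have "c0 * cmod (f z) * k t \<le> exp (- 1) * 2 powr (- b - e) * cmod (f z) * k t / 2"
            unfolding c0_def using e by (auto intro!: mult_right_mono mult_left_mono powr_mono simp: k_nonneg)
          also have "\<dots> \<le> cmod (hausdorff_integrand \<psi> f z t) / 2"
            unfolding f_def using cmod_integrand_ge[OF e(1,3) R z(2) t] by (intro divide_right_mono) auto
          also note Re_ge
          finally show ?thesis .
        qed
        then show "ennreal (c0 * cmod (f z)) * (ennreal (k t) * indicator {1 / R..R} t)
            \<le> ennreal (Re (hausdorff_integrand \<psi> f z t))"
          using c0 k_nonneg[of t] by (auto simp: indicator_def simp flip: ennreal_mult intro!: ennreal_leI)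
      qed
      also have "\<dots> = ennreal (\<integral>t. Re (hausdorff_integrand \<psi> f z t) \<partial>lborel)"
        using ii Re0 by (intro nn_integral_eq_integral) auto
      also have "(\<integral>t. Re (hausdorff_integrand \<psi> f z t) \<partial>lborel) = Re (T f z)"
        unfolding T_def using ii by simp
      also have "ennreal (Re (T f z)) \<le> ennreal (cmod (T f z))"
        by (intro ennreal_leI complex_Re_le_cmod)
      finally show ?thesis by (simp add: f_def)
    qed
    \<comment> \<open>Evaluating \<open>lower\<close> at the single point i R with e = 1 / R
      suffices, since \<open>T\<close> has a finite value there.\<close>
    have "I < \<infinity>"
    proof -
      have "\<i> * of_real R \<in> Sec" using R \<kappa> by (simp add: Sec_def)
      then have "ennreal (c0 * cmod (test_fun (b + 1 / R) (\<i> * of_real R))) * I < \<infinity>"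
        using R by (intro le_less_trans[OF lower]) auto
      moreover have "0 < c0 * cmod (test_fun (b + 1 / R) (\<i> * of_real R))"
        using c0 by (simp add: test_fun_def)
      ultimately show ?thesis by (auto simp: ennreal_mult_less_top)
    qed
    then obtain i where i: "0 \<le> i" "I = ennreal i" by (cases I) auto
    \<comment> \<open>Large enough for the box to contain the part of the sector below height R,
      where |Re z| <= \<open>\<kappa>\<close> * (1 + R).\<close>
    define R' where "R' = R + \<kappa> * (1 + R)"
    have R': "0 < R'" "R \<le> R'" "\<kappa> * (1 + R) \<le> R'" using R \<kappa> by (auto simp: R'_def add_pos_pos)
    define Box where "Box = {z. 0 < Im z \<and> Im z \<le> R' \<and> \<bar>Re z\<bar> \<le> R'}"
    have "(\<integral>\<^sup>+z\<in>Box. ennreal (Im z powr (\<alpha> - 1)) \<partial>lborel) < \<infinity>"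
      unfolding Box_def by (rule weight_on_box_finite[OF \<alpha> R'(1)])
    then obtain w where w: "0 \<le> w" "(\<integral>\<^sup>+z\<in>Box. ennreal (Im z powr (\<alpha> - 1)) \<partial>lborel) = ennreal w"
      by (cases "\<integral>\<^sup>+z\<in>Box. ennreal (Im z powr (\<alpha> - 1)) \<partial>lborel") auto
    \<comment> \<open>The first entry gives e * R <= 1. The second makes the mass m >= c' / e
      satisfy c * m >= 2 * (w + 1), so the low part, of mass at most w, is less than half of c *
      m.\<close>
    define e where "e = min (1 / R) (c' * c / (2 * (w + 1)))"
    have "e \<le> 1 / R" by (simp add: e_def)
    then have "e * R \<le> 1" using R by (simp add: field_simps)
    moreover have "1 / R \<le> 1" using R by simp
    moreover have "0 < e"
      unfolding e_def using R c(1) c'(1) w(1) by (simp add: add_nonneg_pos)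
    ultimately have e: "0 < e" "e * R \<le> 1" "e \<le> 1"
      using \<open>e \<le> 1 / R\<close> by linarith+
    define f where "f = test_fun (b + e)"
    have fB: "f \<in> bergman_space p \<alpha>" unfolding f_def by (rule test_fun_bergman[OF e(1)])
    then obtain m where m: "0 \<le> m" "bergman_mass p \<alpha> f = ennreal m"
      by (cases "bergman_mass p \<alpha> f") (auto simp: bergman_space_iff)
    have "c' / e \<le> m"
      using c'(2)[OF e(1,3)] m by (simp add: f_def)
    moreover have "2 * (w + 1) / c \<le> c' / e"
    proof -
      have "e \<le> c' * c / (2 * (w + 1))" by (simp add: e_def)
      then show ?thesis using e(1) c(1) c'(1) w(1) by (simp add: field_simps)
    qed
    ultimately have "2 * (w + 1) / c \<le> m" by linarith
    then have mw: "2 * (w + 1) \<le> c * m"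
      using c(1) by (simp add: pos_divide_le_eq mult.commute)
    then have mpos: "0 < m" using w(1) m(1) by (cases "m = 0") auto
    define X where "X = (\<integral>\<^sup>+z\<in>Sec \<inter> {z. R \<le> Im z}. D e z \<partial>lborel)"
    have SecU: "Sec \<subseteq> upper_half_plane" by (auto simp: Sec_def upper_half_plane_def)
    have Xm: "X \<le> ennreal m"
      unfolding X_def m(2)[symmetric] bergman_mass_def D_def f_def
      using SecU by (intro nn_integral_mono) (auto simp: indicator_def)
    then obtain x where x: "0 \<le> x" "X = ennreal x" by (cases X) (auto simp: top_unique)
    have [measurable]: "Sec \<in> sets borel" "Box \<in> sets borel" unfolding Sec_def Box_def by measurable
    have Dm: "(\<lambda>z. D e z * indicator (Sec \<inter> {z. R \<le> Im z}) z) \<in> borel_measurable borel"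
    proof -
      note [measurable] = bergman_density_measurable[OF holomorphic_on_imp_continuous_on[OF test_fun_holomorphic], of "b + e" p \<alpha>]
      have "(\<lambda>z. (D e z * indicator upper_half_plane z) * indicator (Sec \<inter> {z. R \<le> Im z}) z) \<in> borel_measurable borel"
        unfolding D_def by measurable
      then show ?thesis
        by (rule measurable_cong[THEN iffD1, rotated]) (use SecU in \<open>auto simp: indicator_def\<close>)
    qed
    have "ennreal c * ennreal m \<le> (\<integral>\<^sup>+z\<in>Sec. D e z \<partial>lborel)"
      using c(2)[OF e(1,3)] m by (simp add: f_def)
    also have "\<dots> \<le> (\<integral>\<^sup>+z. D e z * indicator (Sec \<inter> {z. R \<le> Im z}) z
        + ennreal (Im z powr (\<alpha> - 1)) * indicator Box z \<partial>lborel)"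
    proof (intro nn_integral_mono)
      fix z
      show "D e z * indicator Sec z \<le> D e z * indicator (Sec \<inter> {z. R \<le> Im z}) z
        + ennreal (Im z powr (\<alpha> - 1)) * indicator Box z"
      proof (cases "z \<in> Sec \<and> Im z < R")
        case True
        then have zU: "z \<in> upper_half_plane" using SecU by auto
        have "\<bar>Re z / (1 + Im z)\<bar> \<le> \<kappa>"
          using True by (auto simp: Sec_def abs_le_iff)
        then have "\<bar>Re z\<bar> \<le> \<kappa> * (1 + Im z)"
          using True by (simp add: Sec_def field_simps)
        also have "\<dots> \<le> \<kappa> * (1 + R)" using True \<kappa> by (intro mult_left_mono) auto
        finally have zB: "z \<in> Box" using True R' by (auto simp: Box_def Sec_def)
        have "cmod (test_fun (b + e) z) powr p \<le> 1"
          using cmod_test_fun_le_1[OF zU, of "b + e"] powr_mono2[of p "cmod (test_fun (b + e) z)" 1] p e b_pos by auto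
        then have "D e z \<le> ennreal (Im z powr (\<alpha> - 1))"
          unfolding D_def by (intro ennreal_leI mult_left_le_one_le) auto
        then show ?thesis using True zB by (simp add: add_increasing)
      qed (auto simp: indicator_def)
    qed
    also have "\<dots> = ennreal x + ennreal w"
      using Dm x(2) w(2) by (subst nn_integral_add) (auto simp: X_def)
    finally have "c * m \<le> x + w"
      using c(1) m(1) x(1) w(1) by (simp flip: ennreal_mult ennreal_plus)
    then have xm: "c * m / 2 \<le> x" using mw by simp
    have "ennreal ((c0 * i) powr p) * X \<le> bergman_mass p \<alpha> (T f)"
    proof -
      have "ennreal ((c0 * i) powr p) * X
          = (\<integral>\<^sup>+z. ennreal ((c0 * i) powr p) * (D e z * indicator (Sec \<inter> {z. R \<le> Im z}) z) \<partial>lborel)"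
        unfolding X_def using Dm by (intro nn_integral_cmult[symmetric]) auto
      also have "\<dots> \<le> bergman_mass p \<alpha> (T f)"
        unfolding bergman_mass_def
      proof (intro nn_integral_mono)
        fix z
        show "ennreal ((c0 * i) powr p) * (D e z * indicator (Sec \<inter> {z. R \<le> Im z}) z)
          \<le> ennreal (cmod (T f z) powr p * Im z powr (\<alpha> - 1)) * indicator upper_half_plane z"
        proof (cases "z \<in> Sec \<and> R \<le> Im z")
          case True
          have "c0 * cmod (f z) * i \<le> cmod (T f z)"
            using lower[OF e(1,3,2), of z] True i c0
            by (simp add: f_def flip: ennreal_mult)
          then have "(c0 * i * cmod (f z)) powr p \<le> cmod (T f z) powr p"
            using p c0 i by (intro powr_mono2) (auto simp: mult_ac)
          then have "(c0 * i) powr p * cmod (f z) powr p * Im z powr (\<alpha> - 1) \<le> cmod (T f z) powr p * Im z powr (\<alpha> - 1)"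
            by (intro mult_right_mono) (simp_all add: powr_mult)
          then show ?thesis
            using True SecU by (auto simp: D_def f_def mult.assoc simp flip: ennreal_mult intro!: ennreal_leI)
        qed auto
      qed
      finally show ?thesis .
    qed
    also have "\<dots> \<le> ennreal S * ennreal m" using bd[OF fB] m by simp
    finally have "(c0 * i) powr p * x \<le> S * m"
      using x S m(1) by (simp flip: ennreal_mult)
    moreover have "(c0 * i) powr p * (c * m / 2) \<le> (c0 * i) powr p * x"
      using xm by (intro mult_left_mono) auto
    ultimately have "(c0 * i) powr p * (c * m / 2) \<le> S * m" by linarith
    \<comment> \<open>The mass m cancels, and with it the dependence on e and thus on R.\<close>
    then have "(c0 * i) powr p \<le> 2 * S / c"
      using mpos c(1) by (simp add: field_simps)
    then have "((c0 * i) powr p) powr (1 / p) \<le> (2 * S / c) powr (1 / p)"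
      using p by (intro powr_mono2) auto
    then have "c0 * i \<le> (2 * S / c) powr (1 / p)"
      using p c0 i by (simp add: powr_powr)
    then have "i \<le> L" using c0 by (simp add: L_def field_simps)
    then show ?thesis using i by (simp add: I_def[symmetric] ennreal_leI)
  qed
  then show ?thesis using that by blast
qed

text \<open>The bound for the truncations is independent of R, so monotone convergence along an
  exhaustion of the positive half-line applies.\<close>

lemma k_integrable:
  assumes "\<And>f z. f \<in> bergman_space p \<alpha> \<Longrightarrow> z \<in> upper_half_plane \<Longrightarrow>
      integrable lborel (hausdorff_integrand \<psi> f z)"
    and "0 \<le> S" and "\<And>f. f \<in> bergman_space p \<alpha> \<Longrightarrow>
      bergman_mass p \<alpha> (T f) \<le> ennreal S * bergman_mass p \<alpha> f"
  shows "integrable lborel k"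
proof -
  obtain L where L: "\<And>R. 1 \<le> R \<Longrightarrow> (\<integral>\<^sup>+t\<in>{1 / R..R}. ennreal (k t) \<partial>lborel) \<le> ennreal L"
    using truncated_kernel_bound[OF assms] by blast
  define A where "A n = {1 / real (Suc n)..real (Suc n)}" for n
  have "(\<lambda>n. \<integral>\<^sup>+t. ennreal (k t) * indicator (A n) t \<partial>lborel) \<longlonglongrightarrow> (\<integral>\<^sup>+t. ennreal (k t) \<partial>lborel)"
  proof (rule nn_integral_LIMSEQ)
    have "A m \<subseteq> A n" if "m \<le> n" for m n
      using that unfolding A_def by (intro atLeastatMost_subset_iff[THEN iffD2] disjI2 conjI frac_le) auto
    then show "incseq (\<lambda>n t. ennreal (k t) * indicator (A n) t)"
      by (fastforce simp: incseq_def le_fun_def indicator_def)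
    show "(\<lambda>t. ennreal (k t) * indicator (A n) t) \<in> borel_measurable lborel" for n
      unfolding A_def by measurable
    show "(\<lambda>n. ennreal (k t) * indicator (A n) t) \<longlonglongrightarrow> ennreal (k t)" for t
    proof (cases "0 < t")
      case True
      obtain N where N: "max t (1 / t) < real N" using reals_Archimedean2 by blast
      have "t \<in> A n" if "N \<le> n" for n
      proof -
        have "max t (1 / t) < real (Suc n)" using N that by linarith
        then show ?thesis using True by (simp add: A_def field_simps)
      qed
      then show ?thesis
        by (intro tendsto_eventually eventually_sequentiallyI[of N]) auto
    qed (simp add: k_zero)
  qed
  then have "(\<integral>\<^sup>+t. ennreal (k t) \<partial>lborel) \<le> ennreal L"
    by (rule LIMSEQ_le_const2) (use L in \<open>auto simp: A_def\<close>)
  then show ?thesis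
    by (simp add: integrable_iff_bounded k_nonneg le_less_trans[OF _ ennreal_less_top])
qed

end

section \<open>The lower bound for the norm\<close>

lemma eventually_at_right_0_bound:
  fixes e0 :: real
  assumes "0 < e0"
  shows "eventually (\<lambda>e. 0 < e \<and> e \<le> e0) (at_right 0)"
  using eventually_at_right_real[OF assms] by (rule eventually_mono) auto

context hausdorff_kernel
begin

lemma test_fun_mass_at_top:
  "eventually (\<lambda>e. ennreal M \<le> bergman_mass p \<alpha> (test_fun (b + e))) (at_right 0)"
proof -
  obtain c where c: "0 < c" "\<And>e. 0 < e \<Longrightarrow> e \<le> 1 \<Longrightarrow> ennreal (c / e) \<le> bergman_mass p \<alpha> (test_fun (b + e))"
    using test_fun_mass_lower by blast
  define e0 where "e0 = min 1 (c / (\<bar>M\<bar> + 1))"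
  have "0 < e0" using c(1) by (simp add: e0_def)
  have "ennreal M \<le> bergman_mass p \<alpha> (test_fun (b + e))" if e: "0 < e \<and> e \<le> e0" for e
  proof -
    have "e \<le> c / (\<bar>M\<bar> + 1)" "e \<le> 1" using e by (auto simp: e0_def)
    then have "e * (\<bar>M\<bar> + 1) \<le> c" by (simp add: pos_le_divide_eq)
    then have "\<bar>M\<bar> + 1 \<le> c / e" using e by (simp add: pos_le_divide_eq mult.commute)
    then have "ennreal M \<le> ennreal (c / e)" by (intro ennreal_leI) linarith
    then show ?thesis using c(2)[of e] e \<open>e \<le> 1\<close> by (auto intro: order_trans)
  qed
  then show ?thesis
    using eventually_at_right_0_bound[OF \<open>0 < e0\<close>] by (rule eventually_mono[rotated])
qed

text \<open>Up to the factor \<open>exp E\<close> below, \<open>test_fun\<close> is invariant under the normalized dilations;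
  \<open>E\<close> is small for small \<open>e\<close> and large \<open>z\<close>.\<close>

lemma dil_test_fun:
  assumes t: "0 < t" and z: "z \<in> upper_half_plane"
  obtains E where "dil (test_fun (b + e)) z t = exp E * test_fun (b + e) z"
    "cmod E \<le> \<bar>e\<bar> * \<bar>ln t\<bar> + \<bar>b + e\<bar> * (\<bar>1 - t\<bar> / cmod z)"
proof -
  have z0: "0 < cmod z" using z by (auto simp: upper_half_plane_def)
  have tz: "of_real t - \<i> * z \<noteq> 0"
    using cmod_le_cmod_test_arg[OF z, of t] z0 t by auto
  \<comment> \<open>The normalized dilate equals t powr e * (t - i z) powr -(b + e). Its quotient by
    the test function is t powr e * ((1 - i z) / (t - i z)) powr (b + e), and E is a logarithm of
    that.\<close>
  define E where "E = of_real (e * ln t) + of_real (b + e) * (Ln (1 - \<i> * z) - Ln (of_real t - \<i> * z))"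
  have eq: "of_real t - \<i> * z = of_real t * (1 - \<i> * (z / of_real t))"
    using t by (simp add: field_simps)
  have ne: "1 - \<i> * (z / of_real t) \<noteq> 0"
    using t z by (intro test_fun_arg_ne_0) (simp add: of_real_divide_mem_upper_half_plane)
  have Ln: "Ln (of_real t - \<i> * z) = of_real (ln t) + Ln (1 - \<i> * (z / of_real t))"
    by (simp only: eq Ln_times_of_real[OF t ne] Ln_of_real[OF t])
  have "dil (test_fun (b + e)) z t
      = exp (of_real (- b * ln t)) * exp (- of_real (b + e) * (Ln (of_real t - \<i> * z) - of_real (ln t)))"
    using t by (simp add: dil_def test_fun_def Ln powr_def flip: exp_of_real)
  also have "\<dots> = exp (E + - of_real (b + e) * Ln (1 - \<i> * z))"
    unfolding E_def exp_add[symmetric] by (rule arg_cong[of _ _ exp]) (simp add: algebra_simps)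
  also have "\<dots> = exp E * test_fun (b + e) z"
    by (simp only: exp_add test_fun_def)
  finally have 1: "dil (test_fun (b + e)) z t = exp E * test_fun (b + e) z" .
  \<comment> \<open>The segment from 1 - i z to t - i z is horizontal and consists of points s - i z
    with s >= 0, so its distance from 0 is at least |z|.\<close>
  have "cmod (Ln (1 - \<i> * z) - Ln (of_real t - \<i> * z)) \<le> cmod ((1 - \<i> * z) - (of_real t - \<i> * z)) / cmod z"
  proof (rule cmod_Ln_diff_le[OF z0])
    fix \<zeta> assume "\<zeta> \<in> closed_segment (1 - \<i> * z) (of_real t - \<i> * z)"
    then obtain u where u: "0 \<le> u" "u \<le> 1" "\<zeta> = (1 - u) *\<^sub>R (1 - \<i> * z) + u *\<^sub>R (of_real t - \<i> * z)"
      by (auto simp: closed_segment_def)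
    then have \<zeta>: "\<zeta> = of_real (1 - u + u * t) - \<i> * z"
      by (simp add: scaleR_conv_of_real algebra_simps)
    have "0 \<le> 1 - u + u * t" using u t by simp
    then show "0 < Re \<zeta> \<and> cmod z \<le> cmod \<zeta>"
      using cmod_le_cmod_test_arg[OF z, of "1 - u + u * t"] z
      by (simp add: \<zeta> upper_half_plane_def add_nonneg_pos)
  qed
  also have "cmod ((1 - \<i> * z) - (of_real t - \<i> * z)) = \<bar>1 - t\<bar>"
    by (metis add_diff_cancel_right' diff_add_cancel diff_diff_add diff_diff_eq2 norm_of_real of_real_1 of_real_diff)
  finally have 2: "cmod (Ln (1 - \<i> * z) - Ln (of_real t - \<i> * z)) \<le> \<bar>1 - t\<bar> / cmod z" .
  have "cmod E \<le> cmod (of_real (e * ln t)) + cmod (of_real (b + e) * (Ln (1 - \<i> * z) - Ln (of_real t - \<i> * z)))"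
    unfolding E_def by (rule norm_triangle_ineq)
  also have "\<dots> = \<bar>e\<bar> * \<bar>ln t\<bar> + \<bar>b + e\<bar> * cmod (Ln (1 - \<i> * z) - Ln (of_real t - \<i> * z))"
    by (simp only: norm_mult norm_of_real abs_mult)
  also have "\<dots> \<le> \<bar>e\<bar> * \<bar>ln t\<bar> + \<bar>b + e\<bar> * (\<bar>1 - t\<bar> / cmod z)"
    by (intro add_left_mono mult_left_mono 2) simp
  finally show ?thesis using 1 that by blast
qed

text \<open>Outside a large box E is small and the difference is a small multiple of the test
  function. Inside, the mass of the difference has a bound independent of e, eventually negligible
  because the total mass tends to infinity.\<close>

lemma dil_test_fun_asymp:
  assumes t: "0 < t" and \<delta>: "0 < \<delta>"
  shows "eventually (\<lambda>e. bergman_mass p \<alpha> (\<lambda>z. dil (test_fun (b + e)) z t - test_fun (b + e) z)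
    \<le> ennreal \<delta> * bergman_mass p \<alpha> (test_fun (b + e))) (at_right 0)"
proof -
  define d where "d = (\<delta> / 2) powr (1 / p)"
  have d: "0 < d" "d powr p = \<delta> / 2" using \<delta> p by (auto simp: d_def powr_powr)
  have "isCont exp (0::complex)" by simp
  then obtain \<eta> where \<eta>: "0 < \<eta>" "\<And>E::complex. cmod E < \<eta> \<Longrightarrow> cmod (exp E - 1) < d"
    using d(1) unfolding continuous_at_eps_delta dist_norm by (metis diff_zero exp_zero)
  \<comment> \<open>For |z| > R the second term in the bound of E is at most \<open>\<eta>\<close> /
    2, as b + e <= b + 1.\<close>
  define R where "R = 1 + 2 * (b + 1) * \<bar>1 - t\<bar> / \<eta>"
  have R: "1 \<le> R" using \<eta>(1) b_pos by (simp add: R_def)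
  define Box where "Box = {z. 0 < Im z \<and> Im z \<le> R \<and> \<bar>Re z\<bar> \<le> R}"
  have "(\<integral>\<^sup>+z\<in>Box. ennreal (Im z powr (\<alpha> - 1)) \<partial>lborel) < \<infinity>"
    unfolding Box_def using R by (intro weight_on_box_finite[OF \<alpha>]) auto
  then obtain w where w: "0 \<le> w" "(\<integral>\<^sup>+z\<in>Box. ennreal (Im z powr (\<alpha> - 1)) \<partial>lborel) = ennreal w"
    by (cases "\<integral>\<^sup>+z\<in>Box. ennreal (Im z powr (\<alpha> - 1)) \<partial>lborel") auto
  \<comment> \<open>On the box the dilate is at most t powr -b and the test function at most
    1.\<close>
  define C where "C = (t powr - b + 1) powr p * w"
  have C: "0 \<le> C" using w(1) by (simp add: C_def)
  have Ceq: "ennreal C = ennreal ((t powr - b + 1) powr p) * ennreal w"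
    using w(1) by (simp add: C_def ennreal_mult)
  have [measurable]: "Box \<in> sets borel" unfolding Box_def by measurable
  \<comment> \<open>Makes e * |ln t| strictly less than \<open>\<eta>\<close> / 2; the added 1 gives
    strictness and covers t = 1.\<close>
  define e0 where "e0 = min 1 (\<eta> / (2 * (\<bar>ln t\<bar> + 1)))"
  have e0: "0 < e0" using \<eta>(1) by (simp add: e0_def)
  have est: "bergman_mass p \<alpha> (\<lambda>z. dil (test_fun (b + e)) z t - test_fun (b + e) z)
      \<le> ennreal C + ennreal (\<delta> / 2) * bergman_mass p \<alpha> (test_fun (b + e))" if e: "0 < e \<and> e \<le> e0" for e
  proof -
    have e1: "e \<le> 1" "e \<le> \<eta> / (2 * (\<bar>ln t\<bar> + 1))" using e by (auto simp: e0_def)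
    note [measurable] = bergman_density_measurable[OF holomorphic_on_imp_continuous_on[OF test_fun_holomorphic], of "b + e" p \<alpha>]
    have "bergman_mass p \<alpha> (\<lambda>z. dil (test_fun (b + e)) z t - test_fun (b + e) z)
        \<le> (\<integral>\<^sup>+z. ennreal ((t powr - b + 1) powr p) * (ennreal (Im z powr (\<alpha> - 1)) * indicator Box z)
          + ennreal (\<delta> / 2) * (ennreal (cmod (test_fun (b + e) z) powr p * Im z powr (\<alpha> - 1)) * indicator upper_half_plane z) \<partial>lborel)"
      unfolding bergman_mass_def
    proof (intro nn_integral_mono)
      fix z
      show "ennreal (cmod (dil (test_fun (b + e)) z t - test_fun (b + e) z) powr p * Im z powr (\<alpha> - 1)) * indicator upper_half_plane z
        \<le> ennreal ((t powr - b + 1) powr p) * (ennreal (Im z powr (\<alpha> - 1)) * indicator Box z)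
          + ennreal (\<delta> / 2) * (ennreal (cmod (test_fun (b + e) z) powr p * Im z powr (\<alpha> - 1)) * indicator upper_half_plane z)"
      proof (cases "z \<in> upper_half_plane")
        case z: True
        show ?thesis
        proof (cases "z \<in> Box")
          case True
          have zt: "z / of_real t \<in> upper_half_plane"
            using t z by (simp add: of_real_divide_mem_upper_half_plane)
          have "cmod (dil (test_fun (b + e)) z t) \<le> t powr - b * 1"
            unfolding dil_def norm_mult norm_of_real using e b_pos cmod_test_fun_le_1[OF zt, of "b + e"]
            by (intro mult_mono) auto
          moreover have "cmod (test_fun (b + e) z) \<le> 1"
            using e b_pos by (intro cmod_test_fun_le_1 z) auto
          ultimately have "cmod (dil (test_fun (b + e)) z t - test_fun (b + e) z) \<le> t powr - b + 1"
            using norm_triangle_ineq4[of "dil (test_fun (b + e)) z t" "test_fun (b + e) z"] by simp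
          then have "cmod (dil (test_fun (b + e)) z t - test_fun (b + e) z) powr p * Im z powr (\<alpha> - 1)
              \<le> (t powr - b + 1) powr p * Im z powr (\<alpha> - 1)"
            using p by (intro mult_right_mono powr_mono2) auto
          then show ?thesis
            using True z by (intro add_increasing2) (auto simp flip: ennreal_mult intro!: ennreal_leI)
        next
          case False
          obtain E where E: "dil (test_fun (b + e)) z t = exp E * test_fun (b + e) z"
            "cmod E \<le> \<bar>e\<bar> * \<bar>ln t\<bar> + \<bar>b + e\<bar> * (\<bar>1 - t\<bar> / cmod z)"
            using dil_test_fun[OF t z] by blast
          have zR: "R < cmod z"
            using False z abs_Re_le_cmod[of z] abs_Im_le_cmod[of z]
            by (auto simp: Box_def upper_half_plane_def)
          have "e * (2 * (\<bar>ln t\<bar> + 1)) \<le> \<eta>" using e1(2) by (subst (asm) pos_le_divide_eq) auto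
          then have "e * \<bar>ln t\<bar> < \<eta> / 2" using e by (simp add: algebra_simps)
          moreover have "(b + e) * (\<bar>1 - t\<bar> / cmod z) \<le> \<eta> / 2"
          proof -
            have "2 * (b + 1) * \<bar>1 - t\<bar> / \<eta> \<le> cmod z" using zR by (simp add: R_def)
            then have "2 * (b + 1) * \<bar>1 - t\<bar> \<le> cmod z * \<eta>"
              by (simp only: pos_divide_le_eq[OF \<eta>(1)])
            then have "(b + 1) * \<bar>1 - t\<bar> \<le> \<eta> / 2 * cmod z"
              by (simp add: algebra_simps)
            moreover have "(b + e) * \<bar>1 - t\<bar> \<le> (b + 1) * \<bar>1 - t\<bar>"
              using e1 by (intro mult_right_mono) auto
            ultimately have "(b + e) * \<bar>1 - t\<bar> \<le> \<eta> / 2 * cmod z" by linarith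
            moreover have "0 < cmod z" using zR R by linarith
            ultimately show ?thesis by (simp add: pos_divide_le_eq)
          qed
          moreover have "\<bar>e\<bar> = e" "\<bar>b + e\<bar> = b + e" using e b_pos by auto
          ultimately have "cmod E < \<eta>" using E(2) by linarith
          then have "cmod (exp E - 1) \<le> d" using \<eta>(2) by (simp add: less_imp_le)
          moreover have "dil (test_fun (b + e)) z t - test_fun (b + e) z = (exp E - 1) * test_fun (b + e) z"
            by (simp add: E(1) left_diff_distrib)
          ultimately have "cmod (dil (test_fun (b + e)) z t - test_fun (b + e) z) \<le> d * cmod (test_fun (b + e) z)"
            by (simp add: norm_mult mult_right_mono)
          then have "cmod (dil (test_fun (b + e)) z t - test_fun (b + e) z) powr p
              \<le> (d * cmod (test_fun (b + e) z)) powr p"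
            using p by (intro powr_mono2) auto
          also have "\<dots> = \<delta> / 2 * cmod (test_fun (b + e) z) powr p"
            by (simp add: powr_mult d(2))
          finally have "cmod (dil (test_fun (b + e)) z t - test_fun (b + e) z) powr p * Im z powr (\<alpha> - 1)
              \<le> \<delta> / 2 * cmod (test_fun (b + e) z) powr p * Im z powr (\<alpha> - 1)"
            by (intro mult_right_mono) auto
          then show ?thesis
            using False z \<delta> by (simp add: mult.assoc ennreal_leI flip: ennreal_mult)
        qed
      qed simp
    qed
    also have "\<dots> = ennreal C + ennreal (\<delta> / 2) * bergman_mass p \<alpha> (test_fun (b + e))"
      using w(2) Ceq by (subst nn_integral_add) (auto simp: nn_integral_cmult bergman_mass_def)
    finally show ?thesis .
  qed
  have "eventually (\<lambda>e. 0 < e \<and> e \<le> e0) (at_right 0)"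
    by (rule eventually_at_right_0_bound[OF e0])
  \<comment> \<open>At this threshold C is at most \<open>\<delta>\<close> / 2 times the mass, which
    is the other half of the allowance.\<close>
  moreover have "eventually (\<lambda>e. ennreal (2 * C / \<delta>) \<le> bergman_mass p \<alpha> (test_fun (b + e))) (at_right 0)"
    by (rule test_fun_mass_at_top)
  ultimately show ?thesis
  proof eventually_elim
    case (elim e)
    define m where "m = bergman_mass p \<alpha> (test_fun (b + e))"
    have "ennreal (\<delta> / 2) * ennreal (2 * C / \<delta>) \<le> ennreal (\<delta> / 2) * m"
      using elim(2) by (intro mult_left_mono) (auto simp: m_def)
    then have "ennreal C \<le> ennreal (\<delta> / 2) * m"
      using \<delta> C by (simp flip: ennreal_mult)
    then have "ennreal C + ennreal (\<delta> / 2) * m \<le> ennreal (\<delta> / 2) * m + ennreal (\<delta> / 2) * m"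
      by (rule add_right_mono)
    also have "\<dots> = ennreal \<delta> * m"
      using \<delta> by (simp flip: distrib_right ennreal_plus)
    finally show ?case using est[OF elim(1)] by (simp add: m_def)
  qed
qed

end

lemma bergman_mass_measurable:
  assumes "(\<lambda>(z, t). indicator upper_half_plane z *\<^sub>R G z t) \<in> borel_measurable (borel \<Otimes>\<^sub>M borel)"
  shows "(\<lambda>t::real. bergman_mass p \<alpha> (\<lambda>z. G z t)) \<in> borel_measurable borel"
proof -
  define G' where "G' z t = indicator upper_half_plane z *\<^sub>R G z t" for z t
  have [measurable]: "(\<lambda>(z, t). G' z t) \<in> borel_measurable (borel \<Otimes>\<^sub>M borel)"
    using assms by (simp add: G'_def)
  have "bergman_mass p \<alpha> (\<lambda>z. G z t)
      = (\<integral>\<^sup>+z. ennreal (cmod (G' z t) powr p * Im z powr (\<alpha> - 1)) * indicator upper_half_plane z \<partial>lborel)" for t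
    unfolding bergman_mass_def G'_def by (intro nn_integral_cong) (auto simp: indicator_def)
  then show ?thesis by simp
qed

lemma bergman_mass_cong:
  "(\<And>z. z \<in> upper_half_plane \<Longrightarrow> f z = g z) \<Longrightarrow> bergman_mass p \<alpha> f = bergman_mass p \<alpha> g"
  unfolding bergman_mass_def by (intro nn_integral_cong) (auto simp: indicator_def)

lemma tendsto_zero_ennrealI:
  assumes "\<And>\<delta>. 0 < \<delta> \<Longrightarrow> eventually (\<lambda>n. f n \<le> ennreal \<delta>) F"
  shows "(f \<longlongrightarrow> 0) F"
proof (rule order_tendstoI)
  fix y :: ennreal assume "0 < y"
  then obtain q where q: "0 < q" "q < y" using dense by blast
  then obtain \<delta> where \<delta>: "q = ennreal \<delta>" "0 < \<delta>" by (cases q) auto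
  show "eventually (\<lambda>n. f n < y) F"
    using assms[OF \<delta>(2)] by (rule eventually_mono) (use q \<delta> in auto)
qed simp

context hausdorff_kernel
begin

text \<open>As K is the integral of \<open>k\<close>, the function T f - K f is the average of dil f
  - f with weight \<open>k\<close>, to which Jensen's inequality applies again. The second claim is
  needed for convergence theorems in t.\<close>

lemma bergman_mass_T_diff_le:
  assumes ik: "integrable lborel k" and f: "f \<in> bergman_space p \<alpha>"
  shows "bergman_mass p \<alpha> (\<lambda>z. T f z - of_real K * f z)
    \<le> ennreal (K powr (p - 1)) *
      (\<integral>\<^sup>+t. ennreal (k t) * bergman_mass p \<alpha> (\<lambda>z. indicator {0<..} t *\<^sub>R (dil f z t - f z)) \<partial>lborel)"
    and "(\<lambda>t. bergman_mass p \<alpha> (\<lambda>z. indicator {0<..} t *\<^sub>R (dil f z t - f z))) \<in> borel_measurable borel"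
proof -
  have cf: "continuous_on upper_half_plane f"
    using f holomorphic_on_imp_continuous_on by (auto simp: bergman_space_iff)
  define G where "G z t = indicator {0<..} t *\<^sub>R (dil f z t - f z)" for z t
  have Gm: "(\<lambda>(z, t). indicator upper_half_plane z *\<^sub>R G z t) \<in> borel_measurable (borel \<Otimes>\<^sub>M borel)"
  proof -
    note [measurable] = dil_measurable[OF cf] restrict_upper_half_plane_measurable[OF cf]
    have "(\<lambda>q. (\<lambda>(z, t). indicator upper_half_plane z *\<^sub>R (indicator {0<..} t *\<^sub>R dil f z t)) q
        - indicator {0<..} (snd q) *\<^sub>R (\<lambda>z. indicator upper_half_plane z *\<^sub>R f z) (fst q))
        \<in> borel_measurable (borel \<Otimes>\<^sub>M borel)"
      by measurable
    then show ?thesis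
      by (rule measurable_cong[THEN iffD1, rotated]) (auto simp: G_def indicator_def)
  qed
  have Gk: "G z t * of_real (k t) = hausdorff_integrand \<psi> f z t - f z * of_real (k t)" for z t
    by (simp add: G_def hausdorff_integrand_eq indicator_def k_zero left_diff_distrib)
  have ii: "integrable lborel (hausdorff_integrand \<psi> f z)" if "z \<in> upper_half_plane" for z
    by (rule integrand_integrable[OF ik f that])
  have ik': "integrable lborel (\<lambda>t. f z * of_real (k t))" for z
    using ik by simp
  have "bergman_mass p \<alpha> (\<lambda>z. T f z - of_real K * f z)
      = bergman_mass p \<alpha> (\<lambda>z. \<integral>t. G z t * of_real (k t) \<partial>lborel)"
    unfolding Gk using ii ik' by (intro bergman_mass_cong) (simp add: T_def K_def)
  also have "\<dots> \<le> ennreal (K powr (p - 1)) * (\<integral>\<^sup>+t. ennreal (k t) * bergman_mass p \<alpha> (\<lambda>z. G z t) \<partial>lborel)"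
    unfolding K_def
    using ii ik' by (intro bergman_mass_integral_le p k_nonneg ik Gm) (simp add: Gk)
  finally show "bergman_mass p \<alpha> (\<lambda>z. T f z - of_real K * f z)
    \<le> ennreal (K powr (p - 1)) *
      (\<integral>\<^sup>+t. ennreal (k t) * bergman_mass p \<alpha> (\<lambda>z. indicator {0<..} t *\<^sub>R (dil f z t - f z)) \<partial>lborel)"
    by (simp add: G_def)
  show "(\<lambda>t. bergman_mass p \<alpha> (\<lambda>z. indicator {0<..} t *\<^sub>R (dil f z t - f z))) \<in> borel_measurable borel"
    using bergman_mass_measurable[OF Gm, of p \<alpha>] by (simp add: G_def)
qed

text \<open>The bound, uniform in t, for dominated convergence; it splits at l = 1 / 2 and uses that
  dilates keep the mass.\<close>

lemma bergman_mass_dil_diff_le: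
  assumes f: "continuous_on upper_half_plane f" and t: "0 < t"
  shows "bergman_mass p \<alpha> (\<lambda>z. dil f z t - f z) \<le> ennreal (2 powr p) * bergman_mass p \<alpha> f"
proof -
  have cd: "continuous_on upper_half_plane (\<lambda>z. dil f z t)"
    unfolding dil_def
    by (intro continuous_intros continuous_on_compose2[OF f])
      (use t of_real_divide_mem_upper_half_plane in auto)
  have "bergman_mass p \<alpha> (\<lambda>z. dil f z t - f z)
      \<le> ennreal ((1 - 1 / 2) powr (1 - p)) * bergman_mass p \<alpha> (\<lambda>z. dil f z t)
      + ennreal ((1 / 2) powr (1 - p)) * bergman_mass p \<alpha> f"
    by (intro bergman_mass_add_le p cd f norm_triangle_ineq4) auto
  also have "\<dots> = ennreal ((1 / 2) powr (1 - p) + (1 / 2) powr (1 - p)) * bergman_mass p \<alpha> f"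
  proof -
    have "ennreal (x + x) * y = ennreal x * y + ennreal x * y" if "0 \<le> x" for x y
      by (simp only: ennreal_plus[OF that that] distrib_right)
    from this[of "(1 / 2) powr (1 - p)"] show ?thesis
      by (simp add: bergman_mass_dil[OF f t] del: ennreal_plus)
  qed
  also have "(1 / 2) powr (1 - p) + (1 / 2) powr (1 - p) = (2::real) powr p"
    by (simp add: powr_divide powr_diff)
  finally show ?thesis .
qed

text \<open>Relative to the mass of f n, the mass of T (f n) - K f n tends to 0, by dominated
  convergence in t. Splitting K f n into T (f n) and this error gives the estimate.\<close>

lemma K_le_operator_bound:
  assumes ik: "integrable lborel k" and S: "0 \<le> S"
    and bd: "\<And>f. f \<in> bergman_space p \<alpha> \<Longrightarrow>
      bergman_mass p \<alpha> (T f) \<le> ennreal (S powr p) * bergman_mass p \<alpha> f"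
  shows "K \<le> S"
proof -
  define e where "e n = inverse (real (Suc n))" for n
  have e: "0 < e n" "e n \<le> 1" for n by (auto simp: e_def inverse_le_1_iff)
  have e_lim: "filterlim e (at_right 0) sequentially"
    using LIMSEQ_inverse_real_of_nat e(1)
    by (intro tendsto_imp_filterlim_at_right) (auto simp: e_def[abs_def])
  define f where "f n = test_fun (b + e n)" for n
  have f: "f n \<in> bergman_space p \<alpha>" for n
    unfolding f_def by (rule test_fun_bergman[OF e(1)])
  have hf: "f n holomorphic_on upper_half_plane" for n
    unfolding f_def by (rule test_fun_holomorphic)
  note cf = holomorphic_on_imp_continuous_on[OF hf]
  define m where "m n = enn2real (bergman_mass p \<alpha> (f n))" for n
  have m: "bergman_mass p \<alpha> (f n) = ennreal (m n)" for n
    using f[of n] by (auto simp: m_def bergman_space_iff less_top)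
  have mpos: "0 < m n" for n
  proof -
    obtain c where c: "0 < c" "\<And>e. 0 < e \<Longrightarrow> e \<le> 1 \<Longrightarrow> ennreal (c / e) \<le> bergman_mass p \<alpha> (test_fun (b + e))"
      using test_fun_mass_lower by blast
    have "0 < ennreal (c / e n)" using c(1) e(1) by simp
    also have "\<dots> \<le> ennreal (m n)" using c(2)[OF e] by (simp add: m[symmetric] f_def)
    finally show ?thesis by simp
  qed
  define M where "M n t = bergman_mass p \<alpha> (\<lambda>z. indicator {0<..} t *\<^sub>R (dil (f n) z t - f n z))" for n t
  have M_measurable [measurable]: "M n \<in> borel_measurable borel" for n
    unfolding M_def by (rule bergman_mass_T_diff_le(2)[OF ik f])
  \<comment> \<open>Dividing by the mass under the integral makes the integrand at most 2 powr p * k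
    t, uniformly in n.\<close>
  define q where "q n = (\<integral>\<^sup>+t. ennreal (k t) * (M n t * ennreal (1 / m n)) \<partial>lborel)" for n
  have M_pos: "M n t = bergman_mass p \<alpha> (\<lambda>z. dil (f n) z t - f n z)" if "0 < t" for n t
    using that by (simp add: M_def)
  have q_lim: "q \<longlonglongrightarrow> (\<integral>\<^sup>+t. 0 \<partial>(lborel :: real measure))"
    unfolding q_def
  proof (rule nn_integral_dominated_convergence[where w = "\<lambda>t. ennreal (2 powr p) * ennreal (k t)"])
    show "AE t in lborel. ennreal (k t) * (M n t * ennreal (1 / m n)) \<le> ennreal (2 powr p) * ennreal (k t)" for n
    proof (rule AE_I2)
      fix t
      show "ennreal (k t) * (M n t * ennreal (1 / m n)) \<le> ennreal (2 powr p) * ennreal (k t)"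
      proof (cases "0 < t")
        case True
        have "M n t * ennreal (1 / m n) \<le> ennreal (2 powr p) * ennreal (m n) * ennreal (1 / m n)"
          using bergman_mass_dil_diff_le[OF cf[of n] True]
          by (intro mult_right_mono) (auto simp: M_pos[OF True] m)
        also have "\<dots> = ennreal (2 powr p)"
          using mpos[of n] by (simp flip: ennreal_mult)
        finally show ?thesis by (subst mult.commute[of "ennreal (2 powr p)"], intro mult_left_mono) auto
      qed (simp add: k_zero)
    qed
    show "(\<integral>\<^sup>+t. ennreal (2 powr p) * ennreal (k t) \<partial>lborel) < \<infinity>"
      using ik by (subst nn_integral_cmult) (auto simp: nn_integral_eq_integral k_nonneg ennreal_mult_less_top)
    show "AE t in lborel. (\<lambda>n. ennreal (k t) * (M n t * ennreal (1 / m n))) \<longlonglongrightarrow> 0"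
    proof (rule AE_I2)
      fix t
      show "(\<lambda>n. ennreal (k t) * (M n t * ennreal (1 / m n))) \<longlonglongrightarrow> 0"
      proof (cases "0 < t")
        case True
        have "(\<lambda>n. M n t * ennreal (1 / m n)) \<longlonglongrightarrow> 0"
        proof (rule tendsto_zero_ennrealI)
          fix \<delta> :: real assume \<delta>: "0 < \<delta>"
          have "eventually (\<lambda>n. M n t \<le> ennreal \<delta> * ennreal (m n)) sequentially"
            using eventually_compose_filterlim[OF dil_test_fun_asymp[OF True \<delta>] e_lim]
            by (simp add: M_pos[OF True] f_def[symmetric] m)
          then show "eventually (\<lambda>n. M n t * ennreal (1 / m n) \<le> ennreal \<delta>) sequentially"
          proof (rule eventually_mono)
            fix n assume "M n t \<le> ennreal \<delta> * ennreal (m n)"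
            then have "M n t * ennreal (1 / m n) \<le> ennreal \<delta> * ennreal (m n) * ennreal (1 / m n)"
              by (rule mult_right_mono) simp
            also have "\<dots> = ennreal \<delta>" using mpos[of n] \<delta> by (simp flip: ennreal_mult)
            finally show "M n t * ennreal (1 / m n) \<le> ennreal \<delta>" .
          qed
        qed
        from ennreal_tendsto_cmult[OF ennreal_less_top this, of "k t"] show ?thesis by simp
      qed (simp add: k_zero)
    qed
  qed simp_all
  then have q0: "q \<longlonglongrightarrow> 0" by simp
  have diff: "bergman_mass p \<alpha> (\<lambda>z. T (f n) z - of_real K * f n z) \<le> ennreal (K powr (p - 1)) * (q n * ennreal (m n))" for n
  proof -
    have "(\<integral>\<^sup>+t. ennreal (k t) * M n t \<partial>lborel) = (\<integral>\<^sup>+t. ennreal (k t) * (M n t * ennreal (1 / m n)) * ennreal (m n) \<partial>lborel)"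
    proof (intro nn_integral_cong)
      fix t
      have "ennreal (1 / m n) * ennreal (m n) = 1" using mpos[of n] by (simp flip: ennreal_mult)
      then show "ennreal (k t) * M n t = ennreal (k t) * (M n t * ennreal (1 / m n)) * ennreal (m n)"
        by (simp add: mult.assoc)
    qed
    also have "\<dots> = q n * ennreal (m n)" unfolding q_def by (intro nn_integral_multc) measurable
    finally show ?thesis
      using bergman_mass_T_diff_le(1)[OF ik f, of n] by (simp add: M_def)
  qed
  \<comment> \<open>First \<open>\<epsilon>\<close> tends to 0 with l fixed, since the error carries
    the factor l powr (1 - p), which is unbounded for p > 1; only then does l tend to 0.\<close>
  have main: "K powr p \<le> (1 - l) powr (1 - p) * S powr p + l powr (1 - p) * K powr (p - 1) * \<epsilon>"
    if l: "0 < l" "l < 1" and \<epsilon>: "0 < \<epsilon>" for l \<epsilon>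
  proof -
    have "eventually (\<lambda>n. q n < ennreal \<epsilon>) sequentially"
      using q0 \<epsilon> by (intro order_tendstoD(2)) auto
    then obtain n where n: "q n < ennreal \<epsilon>" by (auto simp: eventually_sequentially)
    define Z where "Z = (1 - l) powr (1 - p) * S powr p + l powr (1 - p) * K powr (p - 1) * \<epsilon>"
    have Z: "0 \<le> Z" using \<epsilon> by (simp add: Z_def)
    have cT: "continuous_on upper_half_plane (T (f n))"
      using T_holomorphic[OF ik f] by (rule holomorphic_on_imp_continuous_on)
    have "ennreal (K powr p) * ennreal (m n) = bergman_mass p \<alpha> (\<lambda>z. of_real K * f n z)"
      using K_nonneg by (subst bergman_mass_cmult[OF cf]) (simp add: m)
    also have "\<dots> \<le> ennreal ((1 - l) powr (1 - p)) * bergman_mass p \<alpha> (T (f n))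
        + ennreal (l powr (1 - p)) * bergman_mass p \<alpha> (\<lambda>z. T (f n) z - of_real K * f n z)"
    proof (intro bergman_mass_add_le p l cT)
      show "continuous_on upper_half_plane (\<lambda>z. T (f n) z - of_real K * f n z)"
        using cT cf by (intro continuous_intros)
      show "cmod (of_real K * f n z) \<le> cmod (T (f n) z) + cmod (T (f n) z - of_real K * f n z)" for z
        using norm_triangle_ineq4[of "T (f n) z" "T (f n) z - of_real K * f n z"] by simp
    qed
    also have "\<dots> \<le> ennreal ((1 - l) powr (1 - p)) * (ennreal (S powr p) * ennreal (m n))
        + ennreal (l powr (1 - p)) * (ennreal (K powr (p - 1)) * (ennreal \<epsilon> * ennreal (m n)))"
      using bd[OF f, of n] n
      by (intro add_mono mult_left_mono order_trans[OF diff] mult_right_mono) (auto simp: m)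
    also have "\<dots> = ennreal (Z * m n)"
      using \<epsilon> mpos[of n] by (simp add: Z_def distrib_right mult.assoc flip: ennreal_mult ennreal_plus)
    also have "ennreal (K powr p) * ennreal (m n) = ennreal (K powr p * m n)"
      using mpos[of n] by (simp add: ennreal_mult)
    finally have "K powr p * m n \<le> Z * m n"
      using mpos[of n] Z by (subst (asm) ennreal_le_iff) auto
    then show ?thesis using mpos[of n] by (simp add: Z_def)
  qed
  have l_bound: "K powr p \<le> (1 - l) powr (1 - p) * S powr p" if l: "0 < l" "l < 1" for l
  proof (rule field_le_epsilon)
    fix \<eta> :: real assume \<eta>: "0 < \<eta>"
    define a where "a = l powr (1 - p) * K powr (p - 1)"
    have a: "0 \<le> a" by (simp add: a_def)
    have "K powr p \<le> (1 - l) powr (1 - p) * S powr p + a * (\<eta> / (a + 1))"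
      using main[OF l, of "\<eta> / (a + 1)"] \<eta> a by (simp add: a_def add_nonneg_pos)
    moreover have "a * (\<eta> / (a + 1)) \<le> \<eta>" using a \<eta> by (simp add: field_simps)
    ultimately show "K powr p \<le> (1 - l) powr (1 - p) * S powr p + \<eta>" by linarith
  qed
  have "((\<lambda>l. (1 - l) powr (1 - p) * S powr p) \<longlongrightarrow> (1 - 0) powr (1 - p) * S powr p) (at_right 0)"
    by (intro tendsto_intros) auto
  moreover have "eventually (\<lambda>l. K powr p \<le> (1 - l) powr (1 - p) * S powr p) (at_right 0)"
    using eventually_at_right_0_bound[of "1 / 2"] l_bound by (auto elim!: eventually_mono)
  ultimately have "K powr p \<le> (1 - 0) powr (1 - p) * S powr p"
    by (intro tendsto_lowerbound) auto
  then have "K powr p \<le> S powr p" by simp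
  then show ?thesis
    using powr_less_mono2[of p S K] p S by (cases "K \<le> S") auto
qed

end

section \<open>The operator norm\<close>

text \<open>The operators \<open>hausdorff_op\<close> and \<open>T\<close> will agree only on the
  half-plane.\<close>

lemma bergman_space_cong:
  assumes "\<And>z. z \<in> upper_half_plane \<Longrightarrow> f z = g z"
  shows "f \<in> bergman_space p \<alpha> \<longleftrightarrow> g \<in> bergman_space p \<alpha>"
    and "bergman_norm p \<alpha> f = bergman_norm p \<alpha> g"
proof -
  show "f \<in> bergman_space p \<alpha> \<longleftrightarrow> g \<in> bergman_space p \<alpha>"
    using bergman_mass_cong[of f g p \<alpha>] holomorphic_cong[of upper_half_plane upper_half_plane f g] assms
    by (simp add: bergman_space_iff)
  have "indicator upper_half_plane z *\<^sub>R (cmod (f z) powr p * Im z powr (\<alpha> - 1))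
      = indicator upper_half_plane z *\<^sub>R (cmod (g z) powr p * Im z powr (\<alpha> - 1))" for z
    using assms by (simp add: indicator_def)
  then show "bergman_norm p \<alpha> f = bergman_norm p \<alpha> g"
    unfolding bergman_norm_def set_lebesgue_integral_def by (simp only:)
qed

lemma bergman_norm_nonneg: "0 \<le> bergman_norm p \<alpha> f"
  by (simp add: bergman_norm_def)

lemma bergman_space_cmult:
  assumes "f \<in> bergman_space p \<alpha>"
  shows "(\<lambda>z. c * f z) \<in> bergman_space p \<alpha>"
proof -
  have f: "f holomorphic_on upper_half_plane" "bergman_mass p \<alpha> f < \<infinity>"
    using assms by (auto simp: bergman_space_iff)
  then show ?thesis
    using bergman_mass_cmult[OF holomorphic_on_imp_continuous_on[OF f(1)], of p \<alpha> c]
    by (auto simp: bergman_space_iff ennreal_mult_less_top intro!: holomorphic_intros)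
qed

lemma bergman_norm_cmult:
  assumes "f \<in> bergman_space p \<alpha>" "0 < p"
  shows "bergman_norm p \<alpha> (\<lambda>z. c * f z) = cmod c * bergman_norm p \<alpha> f"
proof -
  have "f holomorphic_on upper_half_plane" using assms by (simp add: bergman_space_iff)
  then have "bergman_mass p \<alpha> (\<lambda>z. c * f z) = ennreal (cmod c powr p) * bergman_mass p \<alpha> f"
    by (intro bergman_mass_cmult holomorphic_on_imp_continuous_on)
  then show ?thesis
    using assms(2) by (simp add: bergman_norm_eq[OF assms(1)] bergman_norm_eq[OF bergman_space_cmult[OF assms(1)]]
        enn2real_mult powr_mult powr_powr)
qed

context hausdorff_kernel
begin

text \<open>Dividing by any r above the norm of f and letting r decrease to it also settles
  functions of norm 0.\<close>

lemma bergman_norm_T_le_of_unit_ball: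
  assumes TS: "\<And>f. f \<in> bergman_space p \<alpha> \<Longrightarrow> T f \<in> bergman_space p \<alpha>"
    and S: "\<And>f. f \<in> bergman_space p \<alpha> \<Longrightarrow> bergman_norm p \<alpha> f \<le> 1 \<Longrightarrow> bergman_norm p \<alpha> (T f) \<le> S"
    and f: "f \<in> bergman_space p \<alpha>"
  shows "bergman_norm p \<alpha> (T f) \<le> S * bergman_norm p \<alpha> f"
proof -
  have p0: "0 < p" using p by simp
  have bound: "bergman_norm p \<alpha> (T f) \<le> S * r" if r: "bergman_norm p \<alpha> f < r" for r
  proof -
    have r0: "0 < r" using bergman_norm_nonneg r by (rule le_less_trans)
    define g where "g z = of_real (1 / r) * f z" for z
    have g: "g \<in> bergman_space p \<alpha>" unfolding g_def by (rule bergman_space_cmult[OF f])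
    have "cmod (of_real (1 / r)) = 1 / r" using r0 by (simp only: norm_of_real) simp
    then have n: "bergman_norm p \<alpha> g = bergman_norm p \<alpha> f / r"
      "bergman_norm p \<alpha> (T g) = bergman_norm p \<alpha> (T f) / r"
      unfolding g_def T_cmult[abs_def]
      by (simp_all only: bergman_norm_cmult[OF f p0] bergman_norm_cmult[OF TS[OF f] p0]) simp_all
    then have "bergman_norm p \<alpha> g \<le> 1" using r r0 by simp
    then have "bergman_norm p \<alpha> (T f) / r \<le> S" using S[OF g] n by simp
    then show ?thesis using r0 by (simp add: pos_divide_le_eq)
  qed
  have "((\<lambda>r. S * r) \<longlongrightarrow> S * bergman_norm p \<alpha> f) (at_right (bergman_norm p \<alpha> f))"
    by (intro tendsto_intros)
  moreover have "eventually (\<lambda>r. bergman_norm p \<alpha> (T f) \<le> S * r) (at_right (bergman_norm p \<alpha> f))"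
    using eventually_at_right_less by (rule eventually_mono) (rule bound)
  ultimately show ?thesis by (intro tendsto_lowerbound) auto
qed

lemma bergman_mass_T_le_of_norm:
  assumes S: "0 \<le> S" and "f \<in> bergman_space p \<alpha>" "T f \<in> bergman_space p \<alpha>"
    and "bergman_norm p \<alpha> (T f) \<le> S * bergman_norm p \<alpha> f"
  shows "bergman_mass p \<alpha> (T f) \<le> ennreal (S powr p) * bergman_mass p \<alpha> f"
proof -
  have "ennreal (bergman_norm p \<alpha> (T f) powr p) \<le> ennreal ((S * bergman_norm p \<alpha> f) powr p)"
    using assms p by (intro ennreal_leI powr_mono2) (auto simp: bergman_norm_nonneg)
  also have "\<dots> = ennreal (S powr p) * ennreal (bergman_norm p \<alpha> f powr p)"
    using S by (simp add: powr_mult bergman_norm_nonneg ennreal_mult)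
  finally show ?thesis using assms p by (simp add: ennreal_bergman_norm_powr)
qed

end

theorem corollary1p1:
  fixes p \<alpha> :: real and \<phi> :: "real \<Rightarrow> real"
  assumes "1 \<le> p" and "0 < \<alpha>"
    and "set_borel_measurable lebesgue {0<..} \<phi>"
    and "\<forall>t>0. 0 \<le> \<phi> t"
  shows "(hausdorff_bounded_on_bergman p \<alpha> \<phi> \<longleftrightarrow>
            set_integrable lebesgue {0<..} (\<lambda>t. t powr ((1 + \<alpha>) / p - 1) * \<bar>\<phi> t\<bar>)) \<and>
         (hausdorff_bounded_on_bergman p \<alpha> \<phi> \<longrightarrow>
            bergman_op_norm p \<alpha> (hausdorff_op \<phi>) =
              (LINT t:{0<..}|lebesgue. t powr ((1 + \<alpha>) / p - 1) * \<phi> t))"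
proof -
  define \<phi>0 where "\<phi>0 t = indicator {0<..} t *\<^sub>R \<phi> t" for t
  have \<phi>0m [measurable]: "\<phi>0 \<in> borel_measurable lebesgue"
    using assms(3) by (simp add: set_borel_measurable_def \<phi>0_def[abs_def])
  obtain g where g [measurable]: "g \<in> borel_measurable lborel" "AE t in lborel. \<phi>0 t = g t"
    using completion_ex_borel_measurable_real[OF \<phi>0m] by blast
  \<comment> \<open>\<open>g\<close> agrees with the kernel only almost everywhere; the truncations
    make it nonnegative and supported on the positive half-line at every point.\<close>
  define \<psi> where "\<psi> t = indicator {0<..} t * max 0 (g t)" for t
  have "AE t in lborel. \<phi>0 t = \<psi> t"
    using g(2) by (rule eventually_mono) (use assms(4) in \<open>auto simp: \<psi>_def \<phi>0_def indicator_def\<close>)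
  then have ae: "AE t in lebesgue. \<phi>0 t = \<psi> t" by (rule AE_completion)
  interpret hausdorff_kernel p \<alpha> \<psi>
  proof
    show "\<psi> \<in> borel_measurable borel" using g(1) unfolding \<psi>_def by simp
  qed (use assms in \<open>auto simp: \<psi>_def\<close>)
  have lebm: "h \<in> borel_measurable lebesgue" if "h \<in> borel_measurable borel" for h :: "real \<Rightarrow> 'b::topological_space"
    using that by (intro measurable_completion) simp
  \<comment> \<open>The exceptional null set in t does not depend on z, and the two operators agree
    at every point of the half-plane.\<close>
  have transfer: "set_integrable lebesgue {0<..} (hausdorff_integrand \<phi> f z) \<longleftrightarrow> integrable lborel (hausdorff_integrand \<psi> f z)"
    "hausdorff_op \<phi> f z = T f z"
    if f: "continuous_on upper_half_plane f" and z: "z \<in> upper_half_plane" for f z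
  proof -
    define F where "F w = indicator upper_half_plane w *\<^sub>R f w" for w
    have "F \<in> borel_measurable borel"
      unfolding F_def by (rule restrict_upper_half_plane_measurable[OF f])
    then have Fm: "(\<lambda>t. F (z / of_real t)) \<in> borel_measurable borel" by measurable
    have "indicator {0<..} t *\<^sub>R hausdorff_integrand \<phi> f z t = F (z / of_real t) * of_real (\<phi>0 t / t)" for t
      using z by (auto simp: hausdorff_integrand_def F_def \<phi>0_def indicator_def of_real_divide_mem_upper_half_plane)
    moreover have "(\<lambda>t. F (z / of_real t) * of_real (\<phi>0 t / t)) \<in> borel_measurable lebesgue"
    proof -
      have [measurable]: "(\<lambda>t::real. t) \<in> borel_measurable lebesgue" by (intro lebm) simp
      show ?thesis using lebm[OF Fm] by measurable
    qed
    ultimately have m1: "(\<lambda>t. indicator {0<..} t *\<^sub>R hausdorff_integrand \<phi> f z t) \<in> borel_measurable lebesgue"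
      by (simp only:)
    have m2: "hausdorff_integrand \<psi> f z \<in> borel_measurable lborel"
      using integrand_measurable[OF f z] by simp
    have ae': "AE t in lebesgue. indicator {0<..} t *\<^sub>R hausdorff_integrand \<phi> f z t = hausdorff_integrand \<psi> f z t"
      using ae by (rule eventually_mono) (auto simp: hausdorff_integrand_def \<phi>0_def indicator_def \<psi>_zero)
    show "set_integrable lebesgue {0<..} (hausdorff_integrand \<phi> f z) \<longleftrightarrow> integrable lborel (hausdorff_integrand \<psi> f z)"
      unfolding set_integrable_def
      using integrable_cong_AE[OF m1 measurable_completion[OF m2] ae'] integrable_completion[OF m2] by simp
    show "hausdorff_op \<phi> f z = T f z"
      unfolding hausdorff_op_def T_def set_lebesgue_integral_def
      using integral_cong_AE[OF m1 measurable_completion[OF m2] ae'] integral_completion[OF m2] by simp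
  qed
  have transfer_k: "set_integrable lebesgue {0<..} (\<lambda>t. t powr ((1 + \<alpha>) / p - 1) * \<bar>\<phi> t\<bar>) \<longleftrightarrow> integrable lborel k"
    "(LINT t:{0<..}|lebesgue. t powr ((1 + \<alpha>) / p - 1) * \<phi> t) = K"
  proof -
    define h where "h t = t powr (b - 1) * \<phi>0 t" for t
    have h: "indicator {0<..} t *\<^sub>R (t powr ((1 + \<alpha>) / p - 1) * \<bar>\<phi> t\<bar>) = h t"
      "indicator {0<..} t *\<^sub>R (t powr ((1 + \<alpha>) / p - 1) * \<phi> t) = h t" for t
      using assms(4) by (auto simp: h_def \<phi>0_def b_def indicator_def)
    have "(\<lambda>t::real. t powr (b - 1)) \<in> borel_measurable lebesgue" by (intro lebm) measurable
    then have m1: "h \<in> borel_measurable lebesgue" unfolding h_def[abs_def] by measurable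
    have m2: "k \<in> borel_measurable lborel" by simp
    have ae': "AE t in lebesgue. h t = k t"
      using ae by (rule eventually_mono) (auto simp: h_def k_def)
    show "set_integrable lebesgue {0<..} (\<lambda>t. t powr ((1 + \<alpha>) / p - 1) * \<bar>\<phi> t\<bar>) \<longleftrightarrow> integrable lborel k"
      unfolding set_integrable_def h
      using integrable_cong_AE[OF m1 measurable_completion[OF m2] ae'] integrable_completion[OF m2] by simp
    show "(LINT t:{0<..}|lebesgue. t powr ((1 + \<alpha>) / p - 1) * \<phi> t) = K"
      unfolding set_lebesgue_integral_def h K_def
      using integral_cong_AE[OF m1 measurable_completion[OF m2] ae'] integral_completion[OF m2] by simp
  qed
  have cont: "continuous_on upper_half_plane f" if "f \<in> bergman_space p \<alpha>" for f
    using that holomorphic_on_imp_continuous_on by (auto simp: bergman_space_iff)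
  have op_space: "hausdorff_op \<phi> f \<in> bergman_space p \<alpha> \<longleftrightarrow> T f \<in> bergman_space p \<alpha>"
    and op_norm: "bergman_norm p \<alpha> (hausdorff_op \<phi> f) = bergman_norm p \<alpha> (T f)"
    if "f \<in> bergman_space p \<alpha>" for f
    using bergman_space_cong[of "hausdorff_op \<phi> f" "T f"] transfer(2)[OF cont[OF that]] by auto
  define V where "V = bergman_op_values p \<alpha> (hausdorff_op \<phi>)"
  have V: "V = {bergman_norm p \<alpha> (T f) |f. f \<in> bergman_space p \<alpha> \<and> bergman_norm p \<alpha> f \<le> 1}"
    unfolding V_def bergman_op_values_def by (rule Collect_cong) (metis op_norm)
  \<comment> \<open>Makes \<open>V\<close> nonempty, as the laws of the real \<open>Sup\<close>
    require.\<close>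
  have zero: "(\<lambda>_. 0) \<in> bergman_space p \<alpha>" "bergman_norm p \<alpha> (\<lambda>_. 0) \<le> 1"
    using assms(1) by (auto simp: bergman_space_iff bergman_mass_def bergman_norm_def)
  have V_ne: "V \<noteq> {}" unfolding V using zero by blast
  have V_nonneg: "0 \<le> v" if "v \<in> V" for v
    using that by (auto simp: V bergman_norm_nonneg)
  \<comment> \<open>Integrability has to come first: for a non-integrable \<open>k\<close> the
    Bochner integral \<open>K\<close> would be 0 by default and K <= Sup V would say
    nothing.\<close>
  have fwd: "integrable lborel k \<and> K \<le> Sup V" if bounded: "hausdorff_bounded_on_bergman p \<alpha> \<phi>"
  proof -
    have bdd: "bdd_above V" using bounded by (simp add: hausdorff_bounded_on_bergman_def V_def)
    have S: "0 \<le> Sup V" using V_ne V_nonneg bdd by (meson all_not_in_conv cSup_upper order_trans)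
    have int: "integrable lborel (hausdorff_integrand \<psi> f z)"
      if "f \<in> bergman_space p \<alpha>" "z \<in> upper_half_plane" for f z
      using bounded that transfer(1)[OF cont] by (auto simp: hausdorff_bounded_on_bergman_def)
    have TS: "T f \<in> bergman_space p \<alpha>" if "f \<in> bergman_space p \<alpha>" for f
      using bounded that op_space by (auto simp: hausdorff_bounded_on_bergman_def)
    have "bergman_norm p \<alpha> (T f) \<le> Sup V" if "f \<in> bergman_space p \<alpha>" "bergman_norm p \<alpha> f \<le> 1" for f
      using that by (intro cSup_upper bdd) (auto simp: V)
    then have bd: "bergman_mass p \<alpha> (T f) \<le> ennreal (Sup V powr p) * bergman_mass p \<alpha> f"
      if "f \<in> bergman_space p \<alpha>" for f
      using that by (intro bergman_mass_T_le_of_norm S TS bergman_norm_T_le_of_unit_ball) auto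
    have ik: "integrable lborel k"
      by (rule k_integrable[OF int powr_ge_zero bd])
    then show ?thesis using K_le_operator_bound[OF ik S bd] by blast
  qed
  have bwd: "hausdorff_bounded_on_bergman p \<alpha> \<phi> \<and> Sup V \<le> K" if ik: "integrable lborel k"
  proof -
    have le: "v \<le> K" if v: "v \<in> V" for v
    proof -
      obtain f where f: "f \<in> bergman_space p \<alpha>" "bergman_norm p \<alpha> f \<le> 1" "v = bergman_norm p \<alpha> (T f)"
        using v by (auto simp: V)
      have "v \<le> K * bergman_norm p \<alpha> f" using bergman_norm_T_le[OF ik f(1)] f(3) by simp
      also have "\<dots> \<le> K * 1" using f(2) K_nonneg by (intro mult_left_mono)
      finally show ?thesis by simp
    qed
    then have "bdd_above V" by (auto simp: bdd_above_def)
    then have "hausdorff_bounded_on_bergman p \<alpha> \<phi>"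
      using transfer(1)[OF cont] integrand_integrable[OF ik] T_bergman_space[OF ik] op_space
      by (auto simp: hausdorff_bounded_on_bergman_def V_def)
    moreover have "Sup V \<le> K" using V_ne le by (rule cSup_least)
    ultimately show ?thesis by blast
  qed
  show ?thesis
    unfolding transfer_k bergman_op_norm_def V_def[symmetric] using fwd bwd by (auto intro: antisym)
qed

end
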